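(* Let $G$ be an ample Hausdorff groupoid, let $R$ be a unital commutative ring, and let $(\Sigma,i,q)$ be a discrete twist (by $R^\times$) over $G$. Suppose that $$X_\Sigma=\{u \in \Sigma^{(0)}: \Sigma^u_u \subseteq \mathrm{Iso}(\Sigma)^\circ\}$$ is dense in $\Sigma^{(0)}$. Let $Q$ be a ring and let $\pi: A_R(G;\Sigma) \to Q$ be a ring homomorphism. Then $\pi$ is injective if and only if $\pi(\iota(f)) \neq 0$ for every nonzero $f \in A_R(\mathrm{Iso}(G)^\circ; \mathrm{Iso}(\Sigma)^\circ)$, where $\iota: A_R(\mathrm{Iso}(G)^\circ; \mathrm{Iso}(\Sigma)^\circ)\to A_R(G;\Sigma)$ is the natural inclusion map.
   Context: A topological groupoid $G$ (range $r(\alpha)=\alpha\alpha^{-1}$, source $s(\alpha)=\alpha^{-1}\alpha$, unit space $G^{(0)}=r(G)=s(G)$) is étale if $s$ (equivalently $r$) is a local homeomorphism. An open subset $U\subseteq G$ is an open bisection if $r|_U$ and $s|_U$ are homeomorphisms onto open subsets of $G^{(0)}$. An étale groupoid is ample if it has a basis of compact open bisections. For $u\in G^{(0)}$, $G_u^u=\{\gamma\in G: r(\gamma)=s(\gamma)=u\}$; $\mathrm{Iso}(G)=\{\gamma\in G: r(\gamma)=s(\gamma)\}$, and $\mathrm{Iso}(G)^\circ$ is its topological interior in $G$. The same notation is used for $\Sigma$. Discrete twist: let $R^\times$ be the group of units of $R$ with the discrete topology. A discrete twist $(\Sigma,i,q)$ by $R^\times$ over an ample Hausdorff groupoid $G$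 is a sequence $G^{(0)}\times R^\times \xrightarrow{i}\Sigma\xrightarrow{q} G$, where $G^{(0)}\times R^\times$ is the trivial group bundle with fibres $R^\times$, $\Sigma$ is a Hausdorff étale groupoid with $\Sigma^{(0)}=i(G^{(0)}\times\{1\})$, and $i,q$ are continuous groupoid homomorphisms restricting to homeomorphisms of unit spaces, such that: (DT1) $i(\{x\}\times R^\times)=q^{-1}(x)$ for every $x\in G^{(0)}$, $i$ is injective, $q$ is surjective; (DT2) for each $\alpha\in G$ there are an open bisection $B_\alpha\ni\alpha$ of $G$ and a continuous map $P_\alpha:B_\alpha\to\Sigma$ with $q\circ P_\alpha=\mathrm{id}_{B_\alpha}$ such that $(\beta,t)\mapsto i(r(\beta),t)P_\alpha(\beta)$ is a homeomorphism from $B_\alpha\times R^\times$ onto $q^{-1}(B_\alpha)$; (DT3) $i(r(\sigma),t)\sigma=\sigma\, i(s(\sigma),t)$ for all $\sigma\in\Sigma$, $t\in R^\times$ (identifying $\Sigma^{(0)}$ with $G^{(0)}$ via $q$). $R^\times$ acts on $\Sigma$ by $t\cdot\sigma=i(r(\sigma),t)\sigma$. Twisted Steinberg algebra: $A_R(G;\Sigma)$ is the $R$-module of locally constant functions $f:\Sigma\to R$ that are $R^\times$-contravariant, i.e. $f(t\cdot\sigma)=t^{-1}f(\sigma)$, and for which $\mathrm{supp}_G(f):=q(\mathrm{supp}(f))$ is compact, where $\mathrm{supp}(f)=\{\sigma: f(\sigma)\neq0\}$. Its product is $(f*g)(\sigma)=\sum_{\alpha} f(S(\alpha))\,g(S(\alpha)^{-1}\sigma)$,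 the sum over $\alpha\in \mathrm{supp}_G(f)$ with $r(\alpha)=r(q(\sigma))$, where $S:G\to\Sigma$ is any (not necessarily continuous) section of $q$; the product is independent of $S$. Subtwists: for an open subgroupoid $H\subseteq G$, restricting $i,q$ gives a discrete twist $H^{(0)}\times R^\times\to q^{-1}(H)\to H$, and $A_R(H;q^{-1}(H))$ is a subalgebra of $A_R(G;\Sigma)$ by extending functions by zero. One has $q^{-1}(\mathrm{Iso}(G)^\circ)=\mathrm{Iso}(\Sigma)^\circ$, so this applies with $H=\mathrm{Iso}(G)^\circ$, giving $A_R(\mathrm{Iso}(G)^\circ;\mathrm{Iso}(\Sigma)^\circ)$ and the natural inclusion. Ring homomorphisms need not be unital. *)

theory Defs
  imports "HOL-Analysis.Analysis"
begin

section \<open>Topological groupoids\<close>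

text \<open>The set of arrows is the topological space of \<open>gtop\<close>. Multiplication is a total function
  whose values matter only on composable pairs, i.e. pairs with \<open>src a = rng b\<close>.\<close>

record 'g tgroupoid =
  gtop :: "'g topology"
  gmult :: "'g \<Rightarrow> 'g \<Rightarrow> 'g" (infixl "\<cdot>\<index>" 70)
  ginv :: "'g \<Rightarrow> 'g"

definition arrows :: "'g tgroupoid \<Rightarrow> 'g set" where
  "arrows G = topspace (gtop G)"

definition rng :: "'g tgroupoid \<Rightarrow> 'g \<Rightarrow> 'g" where
  "rng G a = a \<cdot>\<^bsub>G\<^esub> ginv G a"

definition src :: "'g tgroupoid \<Rightarrow> 'g \<Rightarrow> 'g" where
  "src G a = ginv G a \<cdot>\<^bsub>G\<^esub> a"

definition units :: "'g tgroupoid \<Rightarrow> 'g set" where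
  "units G = rng G ` arrows G"

definition unit_top :: "'g tgroupoid \<Rightarrow> 'g topology" where
  "unit_top G = subtopology (gtop G) (units G)"

definition composable :: "'g tgroupoid \<Rightarrow> ('g \<times> 'g) set" where
  "composable G = {(a, b). a \<in> arrows G \<and> b \<in> arrows G \<and> src G a = rng G b}"

text \<open>Since \<open>rng\<close> and \<open>src\<close> are defined as \<open>a a\<inverse>\<close> and \<open>a\<inverse> a\<close>, the axioms below say precisely
  that the arrows form a small category in which \<open>ginv G a\<close> is the inverse of \<open>a\<close>.\<close>

locale groupoid =
  fixes G :: "'g tgroupoid"
  assumes inv_closed: "a \<in> arrows G \<Longrightarrow> ginv G a \<in> arrows G"
    and mult_closed: "(a, b) \<in> composable G \<Longrightarrow> a \<cdot>\<^bsub>G\<^esub> b \<in> arrows G"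
    and inv_inv: "a \<in> arrows G \<Longrightarrow> ginv G (ginv G a) = a"
    and rng_mult: "(a, b) \<in> composable G \<Longrightarrow> rng G (a \<cdot>\<^bsub>G\<^esub> b) = rng G a"
    and src_mult: "(a, b) \<in> composable G \<Longrightarrow> src G (a \<cdot>\<^bsub>G\<^esub> b) = src G b"
    and assoc: "(a, b) \<in> composable G \<Longrightarrow> (b, c) \<in> composable G
      \<Longrightarrow> (a \<cdot>\<^bsub>G\<^esub> b) \<cdot>\<^bsub>G\<^esub> c = a \<cdot>\<^bsub>G\<^esub> (b \<cdot>\<^bsub>G\<^esub> c)"
    and rng_left: "a \<in> arrows G \<Longrightarrow> rng G a \<cdot>\<^bsub>G\<^esub> a = a"
    and src_right: "a \<in> arrows G \<Longrightarrow> a \<cdot>\<^bsub>G\<^esub> src G a = a"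

locale topological_groupoid = groupoid G for G :: "'g tgroupoid" +
  assumes continuous_mult:
      "continuous_map (subtopology (prod_topology (gtop G) (gtop G)) (composable G)) (gtop G)
        (\<lambda>(a, b). a \<cdot>\<^bsub>G\<^esub> b)"
    and continuous_inv: "continuous_map (gtop G) (gtop G) (ginv G)"

definition local_homeomorphism :: "'a topology \<Rightarrow> 'b topology \<Rightarrow> ('a \<Rightarrow> 'b) \<Rightarrow> bool" where
  "local_homeomorphism X Y f \<longleftrightarrow> (\<forall>x \<in> topspace X. \<exists>U. openin X U \<and> x \<in> U \<and> openin Y (f ` U) \<and>
     homeomorphic_map (subtopology X U) (subtopology Y (f ` U)) f)"

locale etale_groupoid = topological_groupoid G for G :: "'g tgroupoid" +
  assumes src_local_homeomorphism: "local_homeomorphism (gtop G) (unit_top G) (src G)"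

definition open_bisection :: "'g tgroupoid \<Rightarrow> 'g set \<Rightarrow> bool" where
  "open_bisection G U \<longleftrightarrow> openin (gtop G) U \<and>
     openin (unit_top G) (rng G ` U) \<and>
     homeomorphic_map (subtopology (gtop G) U) (subtopology (unit_top G) (rng G ` U)) (rng G) \<and>
     openin (unit_top G) (src G ` U) \<and>
     homeomorphic_map (subtopology (gtop G) U) (subtopology (unit_top G) (src G ` U)) (src G)"

locale ample_groupoid = etale_groupoid G for G :: "'g tgroupoid" +
  assumes compact_open_bisection_basis:
    "\<exists>\<B>. (\<forall>B \<in> \<B>. compactin (gtop G) B \<and> open_bisection G B) \<and>
       openin (gtop G) = arbitrary union_of (\<lambda>B. B \<in> \<B>)"

definition isotropy :: "'g tgroupoid \<Rightarrow> 'g \<Rightarrow> 'g set" where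
  "isotropy G u = {a \<in> arrows G. rng G a = u \<and> src G a = u}"

definition Iso :: "'g tgroupoid \<Rightarrow> 'g set" where
  "Iso G = {a \<in> arrows G. rng G a = src G a}"

definition Iso_interior :: "'g tgroupoid \<Rightarrow> 'g set" where
  "Iso_interior G = gtop G interior_of Iso G"

definition restrict_groupoid :: "'g tgroupoid \<Rightarrow> 'g set \<Rightarrow> 'g tgroupoid" where
  "restrict_groupoid G H = G\<lparr>gtop := subtopology (gtop G) H\<rparr>"

definition groupoid_hom :: "'a tgroupoid \<Rightarrow> 'b tgroupoid \<Rightarrow> ('a \<Rightarrow> 'b) \<Rightarrow> bool" where
  "groupoid_hom G H \<phi> \<longleftrightarrow> (\<forall>a \<in> arrows G. \<phi> a \<in> arrows H) \<and>
     (\<forall>(a, b) \<in> composable G. (\<phi> a, \<phi> b) \<in> composable H \<and> \<phi> (a \<cdot>\<^bsub>G\<^esub> b) = \<phi> a \<cdot>\<^bsub>H\<^esub> \<phi> b)"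


section \<open>Discrete twists\<close>

text \<open>The sort \<open>{comm_ring, comm_monoid_mult}\<close> describes arbitrary unital commutative rings;
  unlike \<open>comm_ring_1\<close> it does not exclude the zero ring.\<close>

definition ring_units :: "'r::{comm_ring, comm_monoid_mult} set" where
  "ring_units = {t. \<exists>u. t * u = 1}"

definition unit_inv :: "'r::{comm_ring, comm_monoid_mult} \<Rightarrow> 'r" where
  "unit_inv t = (THE u. t * u = 1)"

text \<open>The trivial group bundle with discrete fibres over the unit space of \<open>G\<close>.\<close>

definition trivial_bundle ::
    "'g tgroupoid \<Rightarrow> ('g \<times> 'r::{comm_ring, comm_monoid_mult}) tgroupoid" where
  "trivial_bundle G =
     \<lparr>gtop = prod_topology (unit_top G) (discrete_topology ring_units),
      gmult = (\<lambda>(x, t) (y, u). (x, t * u)),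
      ginv = (\<lambda>(x, t). (x, unit_inv t))\<rparr>"

text \<open>Units of \<open>\<Sigma>\<close> are identified with units of \<open>G\<close> via \<open>q\<close>, so \<open>i(r(\<sigma>), t)\<close> is
  \<open>i (q (rng \<Sigma> \<sigma>), t)\<close>.\<close>

definition twist_act ::
    "'s tgroupoid \<Rightarrow> ('g \<times> 'r \<Rightarrow> 's) \<Rightarrow> ('s \<Rightarrow> 'g) \<Rightarrow> 'r \<Rightarrow> 's \<Rightarrow> 's" where
  "twist_act \<Sigma> i q t \<sigma> = i (q (rng \<Sigma> \<sigma>), t) \<cdot>\<^bsub>\<Sigma>\<^esub> \<sigma>"

locale discrete_twist =
  G: ample_groupoid G + \<Sigma>: etale_groupoid \<Sigma>
  for G :: "'g tgroupoid" and \<Sigma> :: "'s tgroupoid" +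
  fixes i :: "'g \<times> 'r::{comm_ring, comm_monoid_mult} \<Rightarrow> 's" and q :: "'s \<Rightarrow> 'g"
  assumes Hausdorff_G: "Hausdorff_space (gtop G)"
    and Hausdorff_\<Sigma>: "Hausdorff_space (gtop \<Sigma>)"
    and units_\<Sigma>: "units \<Sigma> = i ` (units G \<times> {1})"
    and hom_i: "groupoid_hom (trivial_bundle G) \<Sigma> i"
    and continuous_i: "continuous_map (gtop (trivial_bundle G :: ('g \<times> 'r) tgroupoid)) (gtop \<Sigma>) i"
    and homeo_units_i:
      "homeomorphic_map (unit_top (trivial_bundle G :: ('g \<times> 'r) tgroupoid)) (unit_top \<Sigma>) i"
    and hom_q: "groupoid_hom \<Sigma> G q"
    and continuous_q: "continuous_map (gtop \<Sigma>) (gtop G) q"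
    and homeo_units_q: "homeomorphic_map (unit_top \<Sigma>) (unit_top G) q"
    and DT1_exact: "x \<in> units G \<Longrightarrow> i ` ({x} \<times> ring_units) = {\<sigma> \<in> arrows \<Sigma>. q \<sigma> = x}"
    and DT1_inj: "inj_on i (units G \<times> ring_units)"
    and DT1_surj: "q ` arrows \<Sigma> = arrows G"
    and DT2: "\<alpha> \<in> arrows G \<Longrightarrow> \<exists>B P. open_bisection G B \<and> \<alpha> \<in> B \<and>
      continuous_map (subtopology (gtop G) B) (gtop \<Sigma>) P \<and> (\<forall>\<beta> \<in> B. q (P \<beta>) = \<beta>) \<and>
      homeomorphic_map
        (prod_topology (subtopology (gtop G) B) (discrete_topology ring_units))
        (subtopology (gtop \<Sigma>) {\<sigma> \<in> arrows \<Sigma>. q \<sigma> \<in> B})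
        (\<lambda>(\<beta>, t). i (rng G \<beta>, t) \<cdot>\<^bsub>\<Sigma>\<^esub> P \<beta>)"
    and DT3: "\<sigma> \<in> arrows \<Sigma> \<Longrightarrow> t \<in> ring_units \<Longrightarrow>
      i (q (rng \<Sigma> \<sigma>), t) \<cdot>\<^bsub>\<Sigma>\<^esub> \<sigma> = \<sigma> \<cdot>\<^bsub>\<Sigma>\<^esub> i (q (src \<Sigma> \<sigma>), t)"


section \<open>Twisted Steinberg algebras\<close>

definition suppG :: "'s tgroupoid \<Rightarrow> ('s \<Rightarrow> 'g) \<Rightarrow> ('s \<Rightarrow> 'r::zero) \<Rightarrow> 'g set" where
  "suppG \<Sigma> q f = q ` {\<sigma> \<in> arrows \<Sigma>. f \<sigma> \<noteq> 0}"

text \<open>A function on the arrows of \<open>\<Sigma>\<close> is represented by the function on the whole type that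
  vanishes off \<open>arrows \<Sigma>\<close>, so that equality of algebra elements is equality of functions.\<close>

definition twisted_steinberg_algebra ::
    "'g tgroupoid \<Rightarrow> 's tgroupoid \<Rightarrow> ('g \<times> 'r \<Rightarrow> 's) \<Rightarrow> ('s \<Rightarrow> 'g) \<Rightarrow>
     ('s \<Rightarrow> 'r::{comm_ring, comm_monoid_mult}) set" where
  "twisted_steinberg_algebra G \<Sigma> i q = {f.
     (\<forall>\<sigma>. \<sigma> \<notin> arrows \<Sigma> \<longrightarrow> f \<sigma> = 0) \<and>
     (\<forall>\<sigma> \<in> arrows \<Sigma>. \<exists>U. openin (gtop \<Sigma>) U \<and> \<sigma> \<in> U \<and> (\<forall>\<tau> \<in> U. f \<tau> = f \<sigma>)) \<and>
     (\<forall>t \<in> ring_units. \<forall>\<sigma> \<in> arrows \<Sigma>. f (twist_act \<Sigma> i q t \<sigma>) = unit_inv t * f \<sigma>) \<and>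
     compactin (gtop G) (suppG \<Sigma> q f)}"

text \<open>The section \<open>S\<close> of \<open>q\<close> is the one chosen by \<open>inv_into\<close>; the product of algebra elements does
  not depend on this choice. The index set of the sum is finite for such elements, being a compact
  subset of the discrete fibre of \<open>rng G\<close>.\<close>

definition twisted_conv ::
    "'g tgroupoid \<Rightarrow> 's tgroupoid \<Rightarrow> ('s \<Rightarrow> 'g) \<Rightarrow> ('s \<Rightarrow> 'r) \<Rightarrow> ('s \<Rightarrow> 'r) \<Rightarrow>
     's \<Rightarrow> 'r::{comm_ring, comm_monoid_mult}" where
  "twisted_conv G \<Sigma> q f g = (\<lambda>\<sigma>. if \<sigma> \<in> arrows \<Sigma> then
     (let S = inv_into (arrows \<Sigma>) q in
       \<Sum>\<alpha> \<in> {\<alpha> \<in> suppG \<Sigma> q f. rng G \<alpha> = rng G (q \<sigma>)}. f (S \<alpha>) * g (ginv \<Sigma> (S \<alpha>) \<cdot>\<^bsub>\<Sigma>\<^esub> \<sigma>))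
     else 0)"

text \<open>The type class \<open>ring\<close> does not require a multiplicative identity, and the homomorphisms are
  those of non-unital rings.\<close>

definition steinberg_ring_hom ::
    "'g tgroupoid \<Rightarrow> 's tgroupoid \<Rightarrow> ('g \<times> 'r::{comm_ring, comm_monoid_mult} \<Rightarrow> 's) \<Rightarrow>
     ('s \<Rightarrow> 'g) \<Rightarrow> (('s \<Rightarrow> 'r) \<Rightarrow> 'q::ring) \<Rightarrow> bool" where
  "steinberg_ring_hom G \<Sigma> i q \<pi> \<longleftrightarrow>
     (\<forall>f \<in> twisted_steinberg_algebra G \<Sigma> i q. \<forall>g \<in> twisted_steinberg_algebra G \<Sigma> i q.
        \<pi> (\<lambda>\<sigma>. f \<sigma> + g \<sigma>) = \<pi> f + \<pi> g \<and> \<pi> (twisted_conv G \<Sigma> q f g) = \<pi> f * \<pi> g)"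

definition extend_zero :: "'s set \<Rightarrow> ('s \<Rightarrow> 'r::zero) \<Rightarrow> 's \<Rightarrow> 'r" where
  "extend_zero K f = (\<lambda>\<sigma>. if \<sigma> \<in> K then f \<sigma> else 0)"

end

theory Submission
  imports Defs
begin

text \<open>
  Write \<open>A\<close> for the twisted Steinberg algebra and \<open>J\<close> for the interior of the isotropy of \<open>\<Sigma>\<close>. The
  preimage under \<open>q\<close> of the interior of the isotropy of \<open>G\<close> is \<open>J\<close>, so the subalgebra of the statement
  is the set of all elements of \<open>A\<close> that vanish off \<open>J\<close>
  (\<open>restricted_algebra_iff\<close>), and \<open>extend_zero\<close> fixes such functions. Hence one implication is
  trivial, and the other one says that a nonzero ideal of \<open>A\<close> contains a nonzero element vanishing
  off \<open>J\<close> (\<open>nonzero_on_isotropy_in_absorbing_set\<close>).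

  Let \<open>f\<close> be nonzero in the ideal, say \<open>f \<sigma> \<noteq> 0\<close>. Convolving from the left with an element \<open>h\<close> that is
  supported on a bisection around \<open>q \<sigma>\<inverse>\<close> and takes an invertible value at \<open>\<sigma>\<inverse>\<close> translates \<open>f\<close>: the
  result \<open>F\<close> does not vanish at the unit \<open>\<sigma>\<inverse> \<sigma>\<close>. As \<open>F\<close> is locally constant, density yields a unit
  \<open>u\<close> with \<open>F u \<noteq> 0\<close> whose isotropy group lies in \<open>J\<close>. The part of the support of \<open>F\<close> in \<open>G\<close> that lies
  outside the interior of the isotropy is compact, and none of its arrows goes from \<open>q u\<close> to \<open>q u\<close>.
  The set of the pairs (range, source) of these arrows is therefore closed and misses \<open>(q u, q u)\<close>,
  so some neighbourhood \<open>W\<close> of \<open>q u\<close> in the unit space contains both endpoints of none of them.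
  Multiplying \<open>F\<close> on both sides by an element \<open>k\<close> supported in \<open>W\<close> with an invertible value at \<open>u\<close> gives
  the function \<open>k(s \<sigma>) k(r \<sigma>) F \<sigma>\<close>, which vanishes off \<open>J\<close> but not at \<open>u\<close>.

  Closure of \<open>A\<close> under convolution is needed for these special factors only. For them the sum in the
  convolution has at most one nonzero term (\<open>twisted_conv_single\<close>), and this term may be computed with any
  lift of the arrow in question (\<open>section_independence\<close>), in particular with a continuous one.
\<close>

section \<open>Groupoids\<close>

context groupoid
begin

lemma rng_inv [simp]: "a \<in> arrows G \<Longrightarrow> rng G (ginv G a) = src G a"
  by (simp add: rng_def src_def inv_inv)

lemma src_inv [simp]: "a \<in> arrows G \<Longrightarrow> src G (ginv G a) = rng G a"
  by (simp add: rng_def src_def inv_inv)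

lemma composableI: "a \<in> arrows G \<Longrightarrow> b \<in> arrows G \<Longrightarrow> src G a = rng G b \<Longrightarrow> (a, b) \<in> composable G"
  by (simp add: composable_def)

lemma rng_closed [simp]: "a \<in> arrows G \<Longrightarrow> rng G a \<in> arrows G"
  unfolding rng_def by (rule mult_closed, rule composableI) (simp_all add: inv_closed)

lemma src_closed [simp]: "a \<in> arrows G \<Longrightarrow> src G a \<in> arrows G"
  using rng_closed[of "ginv G a"] by (simp add: inv_closed)

lemma rng_rng [simp]: "a \<in> arrows G \<Longrightarrow> rng G (rng G a) = rng G a"
  using rng_mult[OF composableI, of a "ginv G a"] by (simp add: inv_closed rng_def[of G a, symmetric])

lemma src_rng [simp]: "a \<in> arrows G \<Longrightarrow> src G (rng G a) = rng G a"
  using src_mult[OF composableI, of a "ginv G a"] by (simp add: inv_closed rng_def[of G a, symmetric])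

lemma rng_src [simp]: "a \<in> arrows G \<Longrightarrow> rng G (src G a) = src G a"
  using rng_rng[of "ginv G a"] by (simp add: inv_closed)

lemma src_src [simp]: "a \<in> arrows G \<Longrightarrow> src G (src G a) = src G a"
  using src_rng[of "ginv G a"] by (simp add: inv_closed)

lemma units_iff: "u \<in> units G \<longleftrightarrow> u \<in> arrows G \<and> rng G u = u"
  unfolding units_def by force

lemma unit_src: "u \<in> units G \<Longrightarrow> src G u = u"
  using src_rng by (metis units_iff)

lemma rng_units [simp]: "a \<in> arrows G \<Longrightarrow> rng G a \<in> units G"
  and src_units [simp]: "a \<in> arrows G \<Longrightarrow> src G a \<in> units G"
  by (simp_all add: units_iff)

lemma inv_mult_cancel:
  assumes "a \<in> arrows G" "b \<in> arrows G" "src G a = rng G b"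
  shows "ginv G a \<cdot>\<^bsub>G\<^esub> (a \<cdot>\<^bsub>G\<^esub> b) = b"
  using assoc[of "ginv G a" a b] assms
  by (simp add: composable_def inv_closed src_def[of G a, symmetric] rng_left)

lemma mult_inv_cancel:
  assumes "a \<in> arrows G" "b \<in> arrows G" "rng G a = rng G b"
  shows "a \<cdot>\<^bsub>G\<^esub> (ginv G a \<cdot>\<^bsub>G\<^esub> b) = b"
  using inv_mult_cancel[of "ginv G a" b] assms by (simp add: inv_closed inv_inv)

lemma mult_inv_cancel_right:
  assumes "a \<in> arrows G" "b \<in> arrows G" "src G a = src G b"
  shows "(b \<cdot>\<^bsub>G\<^esub> ginv G a) \<cdot>\<^bsub>G\<^esub> a = b"
  using assoc[of b "ginv G a" a] assms
  by (simp add: composable_def inv_closed src_def[of G a, symmetric] src_right)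

text \<open>Groupoid homomorphisms are only required to preserve products; that they preserve units, and
  therefore ranges, sources and inverses, follows from this characterisation.\<close>

lemma idempotent_unit:
  assumes "(a, a) \<in> composable G" "a \<cdot>\<^bsub>G\<^esub> a = a"
  shows "a \<in> units G"
proof -
  have "ginv G a \<cdot>\<^bsub>G\<^esub> (a \<cdot>\<^bsub>G\<^esub> a) = a" and a: "a \<in> arrows G"
    using assms(1) by (auto simp: composable_def intro: inv_mult_cancel)
  then have "src G a = a"
    by (simp add: assms(2) src_def)
  then show ?thesis
    using a src_units by metis
qed

lemma unit_of_inv_mult_unit:
  assumes "a \<in> arrows G" "b \<in> arrows G" "rng G a = rng G b"
    and "ginv G a \<cdot>\<^bsub>G\<^esub> b \<in> units G"
  shows "a = b"
proof -
  have comp: "(ginv G a, b) \<in> composable G"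
    using assms by (simp add: composable_def inv_closed)
  have "ginv G a \<cdot>\<^bsub>G\<^esub> b = src G a"
    using assms rng_mult[OF comp] by (simp add: units_iff)
  then show ?thesis
    using mult_inv_cancel[of a b] assms(1-3) by (simp add: src_right)
qed

end

lemma groupoid_hom_rng:
  assumes "groupoid G" "groupoid H" "groupoid_hom G H \<phi>" "a \<in> arrows G"
  shows "\<phi> (rng G a) = rng H (\<phi> a)"
proof -
  interpret G: groupoid G by fact
  interpret H: groupoid H by fact
  have comp: "(rng G a, rng G a) \<in> composable G" "(rng G a, a) \<in> composable G"
    using assms(4) by (simp_all add: composable_def)
  have eq: "rng G a \<cdot>\<^bsub>G\<^esub> rng G a = rng G a"
    using G.rng_left[of "rng G a"] assms(4) by simp
  have "\<phi> (rng G a) \<in> units H"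
    using assms(3) comp(1) eq by (intro H.idempotent_unit) (auto simp: groupoid_hom_def)
  moreover have "(\<phi> (rng G a), \<phi> a) \<in> composable H"
    using assms(3) comp(2) by (auto simp: groupoid_hom_def)
  ultimately show ?thesis
    by (simp add: composable_def H.unit_src)
qed

lemma groupoid_hom_inv:
  assumes "groupoid G" "groupoid H" "groupoid_hom G H \<phi>" "a \<in> arrows G"
  shows "\<phi> (ginv G a) = ginv H (\<phi> a)"
proof -
  interpret G: groupoid G by fact
  interpret H: groupoid H by fact
  have comp: "(a, ginv G a) \<in> composable G"
    using assms(4) by (simp add: composable_def G.inv_closed)
  then have *: "(\<phi> a, \<phi> (ginv G a)) \<in> composable H"
      "\<phi> (rng G a) = \<phi> a \<cdot>\<^bsub>H\<^esub> \<phi> (ginv G a)"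
    using assms(3) by (auto simp: groupoid_hom_def rng_def)
  have "\<phi> (ginv G a) = ginv H (\<phi> a) \<cdot>\<^bsub>H\<^esub> rng H (\<phi> a)"
    using H.inv_mult_cancel[of "\<phi> a" "\<phi> (ginv G a)"] * groupoid_hom_rng[OF assms]
    by (simp add: composable_def)
  also have "\<dots> = ginv H (\<phi> a)"
    using H.src_right[of "ginv H (\<phi> a)"] *(1) by (simp add: composable_def H.inv_closed)
  finally show ?thesis .
qed

lemma groupoid_hom_src:
  assumes "groupoid G" "groupoid H" "groupoid_hom G H \<phi>" "a \<in> arrows G"
  shows "\<phi> (src G a) = src H (\<phi> a)"
  using groupoid_hom_rng[OF assms(1-3), of "ginv G a"] groupoid_hom_inv[OF assms] assms
  by (metis groupoid.inv_closed groupoid.rng_inv groupoid_hom_def)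

context topological_groupoid
begin

lemma continuous_rng: "continuous_map (gtop G) (gtop G) (rng G)"
proof -
  have "continuous_map (gtop G) (subtopology (prod_topology (gtop G) (gtop G)) (composable G))
      (\<lambda>a. (a, ginv G a))"
    by (rule continuous_map_into_subtopology)
      (auto simp: continuous_map_pairedI continuous_inv composable_def inv_closed arrows_def[symmetric])
  from continuous_map_compose[OF this continuous_mult] show ?thesis
    by (simp add: o_def rng_def[abs_def])
qed

lemma continuous_src: "continuous_map (gtop G) (gtop G) (src G)"
  using continuous_map_compose[OF continuous_inv continuous_rng]
  by (rule continuous_map_eq) (simp add: arrows_def)

lemma continuous_rng_units: "continuous_map (gtop G) (unit_top G) (rng G)"
  unfolding unit_top_def
  by (rule continuous_map_into_subtopology[OF continuous_rng]) (auto simp: arrows_def[symmetric])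

end

text \<open>The source map is injective near a unit \<open>u\<close> and fixes all sources, so near \<open>u\<close> an arrow and its
  source, having the same source, must coincide.\<close>

lemma (in etale_groupoid) openin_units: "openin (gtop G) (units G)"
proof (subst openin_subopen, intro ballI)
  fix u assume u: "u \<in> units G"
  then have "u \<in> topspace (gtop G)"
    by (simp add: units_iff arrows_def)
  then obtain U where U: "openin (gtop G) U" "u \<in> U"
      "homeomorphic_map (subtopology (gtop G) U) (subtopology (unit_top G) (src G ` U)) (src G)"
    using src_local_homeomorphism unfolding local_homeomorphism_def by blast
  let ?W = "{a \<in> topspace (gtop G). src G a \<in> U} \<inter> U"
  have inj: "inj_on (src G) U"
    using homeomorphic_imp_injective_map[OF U(3)] openin_subset[OF U(1)]
    by (simp add: Int_absorb1)
  have "?W \<subseteq> units G"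
  proof
    fix a assume a: "a \<in> ?W"
    then have "a \<in> arrows G" by (simp add: arrows_def)
    then have "a = src G a"
      using a inj by (auto dest!: inj_onD[where x = a and y = "src G a"])
    then show "a \<in> units G"
      using src_units \<open>a \<in> arrows G\<close> by metis
  qed
  moreover have "openin (gtop G) ?W"
    using openin_continuous_map_preimage[OF continuous_src U(1)] U(1) by blast
  moreover have "u \<in> ?W"
    using U(2) u \<open>u \<in> topspace (gtop G)\<close> by (simp add: unit_src)
  ultimately show "\<exists>T. openin (gtop G) T \<and> u \<in> T \<and> T \<subseteq> units G" by blast
qed

lemma topspace_unit_top: "groupoid G \<Longrightarrow> topspace (unit_top G) = units G"
  by (auto simp: unit_top_def groupoid.units_iff arrows_def)

lemma open_bisection_openin: "open_bisection G B \<Longrightarrow> openin (gtop G) B"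
  by (simp add: open_bisection_def)

lemma open_bisection_inj:
  assumes "open_bisection G B"
  shows "inj_on (rng G) B"
proof -
  have "homeomorphic_map (subtopology (gtop G) B) (subtopology (unit_top G) (rng G ` B)) (rng G)"
    using assms by (simp add: open_bisection_def)
  from homeomorphic_imp_injective_map[OF this] show ?thesis
    using openin_subset[OF open_bisection_openin[OF assms]] by (simp add: Int_absorb1)
qed

context topological_groupoid
begin

text \<open>Multiplication is defined on the set of composable pairs only; this set is closed because the
  space is Hausdorff, so it meets the compact product in a compact set.\<close>

lemma compactin_mult:
  assumes Hd: "Hausdorff_space (gtop G)" and cpt: "compactin (gtop G) K" "compactin (gtop G) L"
  shows "compactin (gtop G) ((\<lambda>(a, b). a \<cdot>\<^bsub>G\<^esub> b) ` (composable G \<inter> K \<times> L))"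
proof (rule image_compactin[OF _ continuous_mult])
  let ?X = "prod_topology (gtop G) (gtop G)"
  have "closedin ?X {z \<in> topspace ?X. (src G \<circ> fst) z = (rng G \<circ> snd) z}"
    by (intro closedin_continuous_maps_eq[OF Hd] continuous_map_compose[OF continuous_map_fst continuous_src]
        continuous_map_compose[OF continuous_map_snd continuous_rng])
  also have "{z \<in> topspace ?X. (src G \<circ> fst) z = (rng G \<circ> snd) z} = composable G"
    by (auto simp: composable_def arrows_def)
  finally have "compactin ?X (composable G \<inter> K \<times> L)"
    using cpt by (intro closed_Int_compactin) (simp_all add: compactin_Times)
  then show "compactin (subtopology ?X (composable G)) (composable G \<inter> K \<times> L)"
    by (simp add: compactin_subtopology)
qed

end

lemma gtop_restrict_groupoid: "gtop (restrict_groupoid G H) = subtopology (gtop G) H"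
  by (simp add: restrict_groupoid_def)

section \<open>Units of a commutative ring\<close>

lemma unit_inv_eq:
  fixes t u :: "'r::{comm_ring, comm_monoid_mult}"
  assumes "t * u = 1"
  shows "unit_inv t = u"
  unfolding unit_inv_def
proof (rule the_equality)
  fix v assume "t * v = 1"
  then have "v = v * (t * u)" using assms by simp
  also have "\<dots> = (t * v) * u" by (simp only: mult_ac)
  finally show "v = u" using \<open>t * v = 1\<close> by simp
qed (fact assms)

lemma mult_unit_inv: "t \<in> ring_units \<Longrightarrow> t * unit_inv t = 1"
  unfolding ring_units_def using unit_inv_eq by blast

lemma one_ring_units: "1 \<in> ring_units"
  by (auto simp: ring_units_def)

lemma unit_inv_ring_units: "t \<in> ring_units \<Longrightarrow> unit_inv t \<in> ring_units"
  using mult_unit_inv[of t] by (auto simp: ring_units_def mult.commute)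

lemma mult_unit_inv_mult:
  assumes "s \<in> ring_units" "t \<in> ring_units"
  shows "s * t * (unit_inv s * unit_inv t) = 1"
proof -
  have "s * t * (unit_inv s * unit_inv t) = (s * unit_inv s) * (t * unit_inv t)"
    by (simp only: mult_ac)
  then show ?thesis
    using assms by (simp add: mult_unit_inv)
qed

lemma unit_inv_mult:
  "s \<in> ring_units \<Longrightarrow> t \<in> ring_units \<Longrightarrow> unit_inv (s * t) = unit_inv s * unit_inv t"
  by (intro unit_inv_eq mult_unit_inv_mult)

lemma mult_ring_units: "s \<in> ring_units \<Longrightarrow> t \<in> ring_units \<Longrightarrow> s * t \<in> ring_units"
  using mult_unit_inv_mult[of s t] by (auto simp: ring_units_def)

lemma ring_unit_mult_eq_0_iff:
  assumes "t \<in> ring_units"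
  shows "t * a = 0 \<longleftrightarrow> a = 0"
proof
  assume "t * a = 0"
  then have "unit_inv t * (t * a) = 0" by simp
  also have "unit_inv t * (t * a) = (t * unit_inv t) * a" by (simp only: mult_ac)
  finally show "a = 0" using mult_unit_inv[OF assms] by simp
qed simp

section \<open>Locally constant functions\<close>

lemma continuous_map_discrete_iff_locally_constant:
  "continuous_map X (discrete_topology UNIV) f \<longleftrightarrow>
    (\<forall>x \<in> topspace X. \<exists>U. openin X U \<and> x \<in> U \<and> (\<forall>y \<in> U. f y = f x))"
proof
  assume f: "continuous_map X (discrete_topology UNIV) f"
  show "\<forall>x \<in> topspace X. \<exists>U. openin X U \<and> x \<in> U \<and> (\<forall>y \<in> U. f y = f x)"
  proof
    fix x assume "x \<in> topspace X"
    then show "\<exists>U. openin X U \<and> x \<in> U \<and> (\<forall>y \<in> U. f y = f x)"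
      using openin_continuous_map_preimage[OF f, of "{f x}"]
      by (intro exI[of _ "{y \<in> topspace X. f y \<in> {f x}}"]) auto
  qed
next
  assume f: "\<forall>x \<in> topspace X. \<exists>U. openin X U \<and> x \<in> U \<and> (\<forall>y \<in> U. f y = f x)"
  show "continuous_map X (discrete_topology UNIV) f"
    unfolding continuous_map_def
  proof (intro conjI allI impI)
    fix V
    show "openin X {x \<in> topspace X. f x \<in> V}"
    proof (subst openin_subopen, intro ballI)
      fix x assume x: "x \<in> {x \<in> topspace X. f x \<in> V}"
      with f obtain U where U: "openin X U" "x \<in> U" "\<forall>y \<in> U. f y = f x" by blast
      have "U \<subseteq> {x \<in> topspace X. f x \<in> V}"
      proof
        fix y assume "y \<in> U"
        then have "f y = f x" "y \<in> topspace X"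
          using U(3) openin_subset[OF U(1)] by blast+
        then show "y \<in> {x \<in> topspace X. f x \<in> V}" using x by simp
      qed
      with U(1,2) show "\<exists>T. openin X T \<and> x \<in> T \<and> T \<subseteq> {x \<in> topspace X. f x \<in> V}" by blast
    qed
  qed auto
qed

lemma continuous_map_discrete_combine:
  assumes "continuous_map X (discrete_topology UNIV) f" "continuous_map X (discrete_topology UNIV) g"
  shows "continuous_map X (discrete_topology UNIV) (\<lambda>x. c (f x) (g x))"
  unfolding continuous_map_discrete_iff_locally_constant
proof
  fix x assume x: "x \<in> topspace X"
  obtain U where U: "openin X U" "x \<in> U" "\<forall>y \<in> U. f y = f x"
    using bspec[OF assms(1)[unfolded continuous_map_discrete_iff_locally_constant] x] by auto
  obtain V where V: "openin X V" "x \<in> V" "\<forall>y \<in> V. g y = g x"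
    using bspec[OF assms(2)[unfolded continuous_map_discrete_iff_locally_constant] x] by auto
  show "\<exists>U. openin X U \<and> x \<in> U \<and> (\<forall>y\<in>U. c (f y) (g y) = c (f x) (g x))"
  proof (intro exI conjI ballI)
    show "openin X (U \<inter> V)" "x \<in> U \<inter> V"
      using U(1,2) V(1,2) by auto
    show "c (f y) (g y) = c (f x) (g x)" if "y \<in> U \<inter> V" for y
      using that U(3)[rule_format, of y] V(3)[rule_format, of y] by simp
  qed
qed

lemma continuous_map_discrete_local:
  assumes "\<And>x. x \<in> topspace X \<Longrightarrow>
    \<exists>N. openin X N \<and> x \<in> N \<and> continuous_map (subtopology X N) (discrete_topology UNIV) f"
  shows "continuous_map X (discrete_topology UNIV) f"
  unfolding continuous_map_discrete_iff_locally_constant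
proof
  fix x assume x: "x \<in> topspace X"
  obtain N where N: "openin X N" "x \<in> N"
      "continuous_map (subtopology X N) (discrete_topology UNIV) f"
    using assms[OF x] by auto
  have "x \<in> topspace (subtopology X N)"
    using x N(2) by simp
  from bspec[OF N(3)[unfolded continuous_map_discrete_iff_locally_constant] this]
  obtain U where U: "openin (subtopology X N) U \<and> x \<in> U \<and> (\<forall>y \<in> U. f y = f x)"
    by (rule exE)
  then have "openin X U"
    by (intro openin_trans_full[OF conjunct1 N(1)])
  with U show "\<exists>U. openin X U \<and> x \<in> U \<and> (\<forall>y \<in> U. f y = f x)"
    by blast
qed

lemma continuous_map_discrete_vanishing:
  assumes "\<And>x. x \<in> N \<Longrightarrow> f x = 0"
  shows "continuous_map (subtopology X N) (discrete_topology UNIV) f"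
  by (rule continuous_map_eq[of _ _ "\<lambda>_. 0"]) (simp_all add: assms)

section \<open>The fibres of a discrete twist\<close>

context discrete_twist
begin

abbreviation act :: "'r \<Rightarrow> 's \<Rightarrow> 's" where
  "act \<equiv> twist_act \<Sigma> i q"

abbreviation twisted_algebra :: "('s \<Rightarrow> 'r) set" where
  "twisted_algebra \<equiv> twisted_steinberg_algebra G \<Sigma> i q"

definition contravariant :: "('s \<Rightarrow> 'r) \<Rightarrow> bool" where
  "contravariant f \<longleftrightarrow> (\<forall>t \<in> ring_units. \<forall>\<sigma> \<in> arrows \<Sigma>. f (act t \<sigma>) = unit_inv t * f \<sigma>)"

abbreviation locally_constant :: "('s \<Rightarrow> 'r) \<Rightarrow> bool" where
  "locally_constant f \<equiv> continuous_map (gtop \<Sigma>) (discrete_topology UNIV) f"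

lemma q_closed [simp]: "\<sigma> \<in> arrows \<Sigma> \<Longrightarrow> q \<sigma> \<in> arrows G"
  using hom_q by (simp add: groupoid_hom_def)

lemma q_rng [simp]: "\<sigma> \<in> arrows \<Sigma> \<Longrightarrow> q (rng \<Sigma> \<sigma>) = rng G (q \<sigma>)"
  by (rule groupoid_hom_rng[OF \<Sigma>.groupoid_axioms G.groupoid_axioms hom_q])

lemma q_src [simp]: "\<sigma> \<in> arrows \<Sigma> \<Longrightarrow> q (src \<Sigma> \<sigma>) = src G (q \<sigma>)"
  by (rule groupoid_hom_src[OF \<Sigma>.groupoid_axioms G.groupoid_axioms hom_q])

lemma q_inv [simp]: "\<sigma> \<in> arrows \<Sigma> \<Longrightarrow> q (ginv \<Sigma> \<sigma>) = ginv G (q \<sigma>)"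
  by (rule groupoid_hom_inv[OF \<Sigma>.groupoid_axioms G.groupoid_axioms hom_q])

lemma q_mult: "(\<sigma>, \<tau>) \<in> composable \<Sigma> \<Longrightarrow> q (\<sigma> \<cdot>\<^bsub>\<Sigma>\<^esub> \<tau>) = q \<sigma> \<cdot>\<^bsub>G\<^esub> q \<tau>"
  using hom_q by (auto simp: groupoid_hom_def)

lemma q_inj_units:
  assumes "u \<in> units \<Sigma>" "v \<in> units \<Sigma>" "q u = q v"
  shows "u = v"
  using homeomorphic_imp_injective_map[OF homeo_units_q] assms
  by (simp add: topspace_unit_top \<Sigma>.groupoid_axioms inj_on_def)

text \<open>Since \<open>q\<close> is injective on units, composability in \<open>\<Sigma>\<close> can be tested in \<open>G\<close>.\<close>

lemma rng_eq_iff: "\<sigma> \<in> arrows \<Sigma> \<Longrightarrow> \<tau> \<in> arrows \<Sigma> \<Longrightarrow> rng \<Sigma> \<sigma> = rng \<Sigma> \<tau> \<longleftrightarrow> rng G (q \<sigma>) = rng G (q \<tau>)"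
  by (metis \<Sigma>.rng_units q_inj_units q_rng)

lemma src_eq_iff: "\<sigma> \<in> arrows \<Sigma> \<Longrightarrow> \<tau> \<in> arrows \<Sigma> \<Longrightarrow> src \<Sigma> \<sigma> = src \<Sigma> \<tau> \<longleftrightarrow> src G (q \<sigma>) = src G (q \<tau>)"
  by (metis \<Sigma>.src_units q_inj_units q_src)

lemma src_rng_eq_iff:
  "\<sigma> \<in> arrows \<Sigma> \<Longrightarrow> \<tau> \<in> arrows \<Sigma> \<Longrightarrow> src \<Sigma> \<sigma> = rng \<Sigma> \<tau> \<longleftrightarrow> src G (q \<sigma>) = rng G (q \<tau>)"
  by (metis \<Sigma>.src_units \<Sigma>.rng_units q_inj_units q_src q_rng)

lemma q_lift:
  assumes "\<alpha> \<in> arrows G"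
  obtains \<sigma> where "\<sigma> \<in> arrows \<Sigma>" "q \<sigma> = \<alpha>"
  using assms unfolding DT1_surj[symmetric] by (rule imageE) (rule that[OF _ sym])

lemma i_fibre:
  assumes "x \<in> units G" "t \<in> ring_units"
  shows "i (x, t) \<in> arrows \<Sigma>" "q (i (x, t)) = x"
proof -
  have "i (x, t) \<in> i ` ({x} \<times> ring_units)"
    using assms(2) by simp
  then show "i (x, t) \<in> arrows \<Sigma>" "q (i (x, t)) = x"
    unfolding DT1_exact[OF assms(1)] by simp_all
qed

lemma src_i: "\<sigma> \<in> arrows \<Sigma> \<Longrightarrow> t \<in> ring_units \<Longrightarrow> src \<Sigma> (i (rng G (q \<sigma>), t)) = rng \<Sigma> \<sigma>"
  by (simp add: src_rng_eq_iff i_fibre)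

lemma rng_i: "\<sigma> \<in> arrows \<Sigma> \<Longrightarrow> t \<in> ring_units \<Longrightarrow> rng \<Sigma> (i (rng G (q \<sigma>), t)) = rng \<Sigma> \<sigma>"
  by (simp add: rng_eq_iff i_fibre)

lemma i_composable:
  "\<sigma> \<in> arrows \<Sigma> \<Longrightarrow> t \<in> ring_units \<Longrightarrow> (i (rng G (q \<sigma>), t), \<sigma>) \<in> composable \<Sigma>"
  by (simp add: composable_def src_i i_fibre)

lemma act_closed [simp]: "\<sigma> \<in> arrows \<Sigma> \<Longrightarrow> t \<in> ring_units \<Longrightarrow> act t \<sigma> \<in> arrows \<Sigma>"
  by (simp add: twist_act_def \<Sigma>.mult_closed i_composable)

lemma q_act [simp]: "\<sigma> \<in> arrows \<Sigma> \<Longrightarrow> t \<in> ring_units \<Longrightarrow> q (act t \<sigma>) = q \<sigma>"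
  by (simp add: twist_act_def q_mult[OF i_composable] i_fibre G.rng_left)

lemma rng_act [simp]: "\<sigma> \<in> arrows \<Sigma> \<Longrightarrow> t \<in> ring_units \<Longrightarrow> rng \<Sigma> (act t \<sigma>) = rng \<Sigma> \<sigma>"
  and src_act [simp]: "\<sigma> \<in> arrows \<Sigma> \<Longrightarrow> t \<in> ring_units \<Longrightarrow> src \<Sigma> (act t \<sigma>) = src \<Sigma> \<sigma>"
  by (simp_all add: rng_eq_iff src_eq_iff)

lemma i_mult:
  assumes "x \<in> units G" "s \<in> ring_units" "t \<in> ring_units"
  shows "i (x, s) \<cdot>\<^bsub>\<Sigma>\<^esub> i (x, t) = i (x, s * t)"
proof -
  have "((x, s), (x, t)) \<in> composable (trivial_bundle G :: ('g \<times> 'r) tgroupoid)"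
    using assms mult_unit_inv[of s] mult_unit_inv[of t]
    by (simp add: composable_def trivial_bundle_def arrows_def src_def rng_def
        topspace_unit_top G.groupoid_axioms mult.commute)
  then show ?thesis
    using hom_i unfolding groupoid_hom_def by (auto simp: trivial_bundle_def)
qed

lemma act_act:
  assumes "\<sigma> \<in> arrows \<Sigma>" "s \<in> ring_units" "t \<in> ring_units"
  shows "act s (act t \<sigma>) = act (s * t) \<sigma>"
proof -
  have "act s (act t \<sigma>) = i (rng G (q \<sigma>), s) \<cdot>\<^bsub>\<Sigma>\<^esub> (i (rng G (q \<sigma>), t) \<cdot>\<^bsub>\<Sigma>\<^esub> \<sigma>)"
    using assms by (simp add: twist_act_def[of _ _ _ s]) (simp add: twist_act_def)
  also have "\<dots> = (i (rng G (q \<sigma>), s) \<cdot>\<^bsub>\<Sigma>\<^esub> i (rng G (q \<sigma>), t)) \<cdot>\<^bsub>\<Sigma>\<^esub> \<sigma>"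
    using assms by (subst \<Sigma>.assoc) (simp_all add: i_composable composable_def src_i rng_i i_fibre)
  finally show ?thesis
    using assms by (simp add: i_mult twist_act_def)
qed

text \<open>The quotient \<open>\<tau> \<sigma>\<inverse>\<close> lies over a unit, so by exactness it is the image of a scalar.\<close>

lemma fibre_act:
  assumes "\<sigma> \<in> arrows \<Sigma>" "\<tau> \<in> arrows \<Sigma>" "q \<sigma> = q \<tau>"
  obtains t where "t \<in> ring_units" "\<tau> = act t \<sigma>"
proof -
  have src: "src \<Sigma> \<tau> = src \<Sigma> \<sigma>"
    using assms by (simp add: src_eq_iff)
  then have comp: "(\<tau>, ginv \<Sigma> \<sigma>) \<in> composable \<Sigma>"
    using assms by (simp add: composable_def \<Sigma>.inv_closed)
  have "q (\<tau> \<cdot>\<^bsub>\<Sigma>\<^esub> ginv \<Sigma> \<sigma>) = rng G (q \<sigma>)"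
    using assms by (simp add: q_mult[OF comp] rng_def)
  then have "\<tau> \<cdot>\<^bsub>\<Sigma>\<^esub> ginv \<Sigma> \<sigma> \<in> i ` ({rng G (q \<sigma>)} \<times> ring_units)"
    using \<Sigma>.mult_closed[OF comp] assms by (simp add: DT1_exact)
  then obtain t where t: "t \<in> ring_units" "\<tau> \<cdot>\<^bsub>\<Sigma>\<^esub> ginv \<Sigma> \<sigma> = i (rng G (q \<sigma>), t)"
    by auto
  have "\<tau> = act t \<sigma>"
    using \<Sigma>.mult_inv_cancel_right[of \<sigma> \<tau>] src assms t by (simp add: twist_act_def)
  with t(1) show ?thesis by (rule that)
qed

lemma contravariant_nonzero_iff:
  assumes "contravariant f" "\<sigma> \<in> arrows \<Sigma>" "\<tau> \<in> arrows \<Sigma>" "q \<sigma> = q \<tau>"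
  shows "f \<sigma> = 0 \<longleftrightarrow> f \<tau> = 0"
proof -
  obtain t where t: "t \<in> ring_units" "\<tau> = act t \<sigma>"
    using fibre_act assms(2-4) by metis
  then show ?thesis
    using assms by (simp add: contravariant_def ring_unit_mult_eq_0_iff unit_inv_ring_units)
qed

text \<open>By contravariance the support is a union of fibres of \<open>q\<close>, which allows a passage
  between supports in \<open>\<Sigma>\<close> and in \<open>G\<close>.\<close>

lemma in_suppG_iff:
  assumes "contravariant f" "\<sigma> \<in> arrows \<Sigma>"
  shows "q \<sigma> \<in> suppG \<Sigma> q f \<longleftrightarrow> f \<sigma> \<noteq> 0"
proof
  assume "q \<sigma> \<in> suppG \<Sigma> q f"
  then obtain \<tau> where "\<tau> \<in> arrows \<Sigma>" "f \<tau> \<noteq> 0" "q \<tau> = q \<sigma>"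
    unfolding suppG_def by auto
  then show "f \<sigma> \<noteq> 0"
    using contravariant_nonzero_iff[OF assms(1), of \<tau> \<sigma>] assms(2) by blast
qed (use assms(2) in \<open>auto simp: suppG_def\<close>)

lemma act_mult_left:
  assumes "(a, b) \<in> composable \<Sigma>" "t \<in> ring_units"
  shows "act t a \<cdot>\<^bsub>\<Sigma>\<^esub> b = act t (a \<cdot>\<^bsub>\<Sigma>\<^esub> b)"
proof -
  have a: "a \<in> arrows \<Sigma>" using assms(1) by (simp add: composable_def)
  show ?thesis
    using \<Sigma>.assoc[OF i_composable[OF a assms(2)] assms(1)] a assms
    by (simp add: twist_act_def \<Sigma>.rng_mult)
qed

text \<open>This is where centrality of the extension is used: the scalar can be moved past \<open>a\<close>.\<close>

lemma mult_act:
  assumes "(a, b) \<in> composable \<Sigma>" "t \<in> ring_units"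
  shows "a \<cdot>\<^bsub>\<Sigma>\<^esub> act t b = act t (a \<cdot>\<^bsub>\<Sigma>\<^esub> b)"
proof -
  have a: "a \<in> arrows \<Sigma>" and b: "b \<in> arrows \<Sigma>" and ab: "src \<Sigma> a = rng \<Sigma> b"
    using assms(1) by (simp_all add: composable_def)
  have "(a, i (rng G (q b), t)) \<in> composable \<Sigma>"
    using a b ab assms(2) by (simp add: composable_def rng_i i_fibre)
  from \<Sigma>.assoc[OF this i_composable[OF b assms(2)]]
  have "a \<cdot>\<^bsub>\<Sigma>\<^esub> act t b = (a \<cdot>\<^bsub>\<Sigma>\<^esub> i (q (src \<Sigma> a), t)) \<cdot>\<^bsub>\<Sigma>\<^esub> b"
    by (simp add: twist_act_def ab b)
  also have "\<dots> = act t a \<cdot>\<^bsub>\<Sigma>\<^esub> b"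
    by (simp only: DT3[OF a assms(2), symmetric] twist_act_def)
  finally show ?thesis
    by (simp only: act_mult_left[OF assms])
qed

lemma inv_composable:
  "\<rho> \<in> arrows \<Sigma> \<Longrightarrow> \<sigma> \<in> arrows \<Sigma> \<Longrightarrow> rng \<Sigma> \<rho> = rng \<Sigma> \<sigma> \<Longrightarrow> (ginv \<Sigma> \<rho>, \<sigma>) \<in> composable \<Sigma>"
  by (simp add: composable_def \<Sigma>.inv_closed)

text \<open>In a local trivialisation \<open>q\<close> is the projection of a product with a discrete factor.\<close>

lemma open_map_q: "open_map (gtop \<Sigma>) (gtop G) q"
  unfolding open_map_def
proof (intro allI impI)
  fix U assume U: "openin (gtop \<Sigma>) U"
  show "openin (gtop G) (q ` U)"
  proof (subst openin_subopen, intro ballI)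
    fix \<alpha> assume "\<alpha> \<in> q ` U"
    then obtain \<sigma> where \<sigma>: "\<sigma> \<in> U" "\<alpha> = q \<sigma>" by blast
    have UA: "U \<subseteq> arrows \<Sigma>"
      using openin_subset[OF U] by (simp add: arrows_def)
    then have "\<alpha> \<in> arrows G" using \<sigma> by auto
    from DT2[OF this] obtain B P where B: "open_bisection G B" "\<alpha> \<in> B"
      and P: "\<forall>\<beta> \<in> B. q (P \<beta>) = \<beta>" "continuous_map (subtopology (gtop G) B) (gtop \<Sigma>) P"
      and hom: "homeomorphic_map
        (prod_topology (subtopology (gtop G) B) (discrete_topology ring_units))
        (subtopology (gtop \<Sigma>) {\<sigma> \<in> arrows \<Sigma>. q \<sigma> \<in> B})
        (\<lambda>(\<beta>, t). i (rng G \<beta>, t) \<cdot>\<^bsub>\<Sigma>\<^esub> P \<beta>)"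
        (is "homeomorphic_map ?X ?Y ?\<Phi>") by blast
    have oB: "openin (gtop G) B" using B by (simp add: open_bisection_def)
    have topX: "topspace ?X = B \<times> ring_units"
      using openin_subset[OF oB] by auto
    let ?W = "{z \<in> topspace ?X. ?\<Phi> z \<in> U \<inter> {\<sigma> \<in> arrows \<Sigma>. q \<sigma> \<in> B}}"
    have PA: "P \<beta> \<in> arrows \<Sigma>" if "\<beta> \<in> B" for \<beta>
      using that continuous_map_funspace[OF P(2)] openin_subset[OF oB]
      by (auto simp: arrows_def)
    have q\<Phi>: "q (?\<Phi> z) = fst z" if "z \<in> topspace ?X" for z
      using that P(1) PA q_act[OF PA[of "fst z"], of "snd z"]
      unfolding topX by (auto simp: twist_act_def)
    have "openin ?X ?W"
      using openin_continuous_map_preimage[OF homeomorphic_imp_continuous_map[OF hom], of "U \<inter> {\<sigma> \<in> arrows \<Sigma>. q \<sigma> \<in> B}"]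
        U by (simp add: openin_subtopology_Int)
    then have "openin (subtopology (gtop G) B) (fst ` ?W)"
      using open_map_fst unfolding open_map_def by blast
    then have "openin (gtop G) (fst ` ?W)"
      by (rule openin_trans_full[OF _ oB])
    moreover have "\<alpha> \<in> fst ` ?W"
    proof -
      have "\<sigma> \<in> topspace ?Y"
        using \<sigma> UA B(2) by (auto simp: arrows_def)
      then have "\<sigma> \<in> ?\<Phi> ` topspace ?X"
        by (simp only: homeomorphic_imp_surjective_map[OF hom])
      then obtain z where z: "z \<in> topspace ?X" "\<sigma> = ?\<Phi> z"
        by (rule imageE)
      have "fst z = \<alpha>" using q\<Phi>[OF z(1)] z(2) \<sigma>(2) by metis
      moreover have "?\<Phi> z \<in> U \<inter> {\<sigma> \<in> arrows \<Sigma>. q \<sigma> \<in> B}"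
        unfolding z(2)[symmetric] using \<sigma> UA B(2) by blast
      ultimately show ?thesis
        using z(1) by (intro image_eqI[of _ _ z] CollectI conjI) simp_all
    qed
    moreover have "fst ` ?W \<subseteq> q ` U"
    proof (rule image_subsetI)
      fix z assume "z \<in> ?W"
      then have "z \<in> topspace ?X" "?\<Phi> z \<in> U" by blast+
      then show "fst z \<in> q ` U"
        using q\<Phi>[of z] by (intro image_eqI[where f = q and x = "?\<Phi> z"]) simp_all
    qed
    ultimately show "\<exists>T. openin (gtop G) T \<and> \<alpha> \<in> T \<and> T \<subseteq> q ` U" by blast
  qed
qed

text \<open>Since \<open>q\<close> is injective on units, it detects isotropy; being continuous and open, it also
  matches the interiors.\<close>

lemma Iso_interior_eq: "Iso_interior \<Sigma> = {\<sigma> \<in> arrows \<Sigma>. q \<sigma> \<in> Iso_interior G}"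
proof (intro subset_antisym subsetI)
  have Iso: "\<sigma> \<in> Iso \<Sigma> \<longleftrightarrow> q \<sigma> \<in> Iso G" if "\<sigma> \<in> arrows \<Sigma>" for \<sigma>
    using that src_rng_eq_iff[OF that that] by (auto simp: Iso_def)
  {
    fix \<sigma> assume \<sigma>: "\<sigma> \<in> Iso_interior \<Sigma>"
    then have "\<sigma> \<in> arrows \<Sigma>"
      using interior_of_subset[of "gtop \<Sigma>" "Iso \<Sigma>"] by (auto simp: Iso_interior_def Iso_def)
    moreover have "q \<sigma> \<in> Iso_interior G"
      unfolding Iso_interior_def
    proof (rule interior_of_maximal[THEN subsetD])
      show "openin (gtop G) (q ` Iso_interior \<Sigma>)"
        using open_map_q by (simp add: open_map_def Iso_interior_def)
      show "q ` Iso_interior \<Sigma> \<subseteq> Iso G"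
        using interior_of_subset[of "gtop \<Sigma>" "Iso \<Sigma>"] Iso by (auto simp: Iso_interior_def Iso_def)
    qed (use \<sigma> in blast)
    ultimately show "\<sigma> \<in> {\<sigma> \<in> arrows \<Sigma>. q \<sigma> \<in> Iso_interior G}" by simp
  next
    fix \<sigma> assume \<sigma>: "\<sigma> \<in> {\<sigma> \<in> arrows \<Sigma>. q \<sigma> \<in> Iso_interior G}"
    show "\<sigma> \<in> Iso_interior \<Sigma>"
      unfolding Iso_interior_def[of \<Sigma>]
    proof (rule interior_of_maximal[THEN subsetD])
      show "openin (gtop \<Sigma>) {\<sigma> \<in> arrows \<Sigma>. q \<sigma> \<in> Iso_interior G}"
        unfolding arrows_def Iso_interior_def
        by (rule openin_continuous_map_preimage[OF continuous_q]) simp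
      show "{\<sigma> \<in> arrows \<Sigma>. q \<sigma> \<in> Iso_interior G} \<subseteq> Iso \<Sigma>"
        using interior_of_subset[of "gtop G" "Iso G"] Iso by (auto simp: Iso_interior_def)
    qed (fact \<sigma>)
  }
qed

section \<open>Elements of the twisted Steinberg algebra\<close>

lemma algebra_iff:
  "f \<in> twisted_algebra \<longleftrightarrow> (\<forall>\<sigma>. \<sigma> \<notin> arrows \<Sigma> \<longrightarrow> f \<sigma> = 0) \<and> locally_constant f \<and>
     contravariant f \<and> compactin (gtop G) (suppG \<Sigma> q f)"
  by (simp only: twisted_steinberg_algebra_def continuous_map_discrete_iff_locally_constant
      contravariant_def arrows_def mem_Collect_eq)

text \<open>The zero set is open and a union of fibres, and \<open>q\<close> is open. It follows that
  compactness of the support only has to be checked by enclosing it in a compact set.\<close>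

lemma closedin_suppG:
  assumes "locally_constant f" "contravariant f"
  shows "closedin (gtop G) (suppG \<Sigma> q f)"
proof -
  have "openin (gtop \<Sigma>) {\<sigma> \<in> topspace (gtop \<Sigma>). f \<sigma> \<in> {0}}"
    by (rule openin_continuous_map_preimage[OF assms(1)]) simp
  then have "openin (gtop G) (q ` {\<sigma> \<in> topspace (gtop \<Sigma>). f \<sigma> \<in> {0}})"
    using open_map_q by (simp add: open_map_def)
  also have "q ` {\<sigma> \<in> topspace (gtop \<Sigma>). f \<sigma> \<in> {0}} = arrows G - suppG \<Sigma> q f"
  proof (intro set_eqI iffI)
    fix \<alpha> assume "\<alpha> \<in> q ` {\<sigma> \<in> topspace (gtop \<Sigma>). f \<sigma> \<in> {0}}"
    then show "\<alpha> \<in> arrows G - suppG \<Sigma> q f"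
      using in_suppG_iff[OF assms(2)] by (auto simp: arrows_def[of \<Sigma>, symmetric])
  next
    fix \<alpha> assume \<alpha>: "\<alpha> \<in> arrows G - suppG \<Sigma> q f"
    then obtain \<sigma> where "\<sigma> \<in> arrows \<Sigma>" "q \<sigma> = \<alpha>" using q_lift by blast
    then show "\<alpha> \<in> q ` {\<sigma> \<in> topspace (gtop \<Sigma>). f \<sigma> \<in> {0}}"
      using \<alpha> in_suppG_iff[OF assms(2)] by (auto simp: arrows_def[of \<Sigma>, symmetric])
  qed
  finally have "openin (gtop G) (arrows G - suppG \<Sigma> q f)" .
  moreover have "suppG \<Sigma> q f \<subseteq> arrows G"
    by (auto simp: suppG_def)
  ultimately show ?thesis
    by (simp add: closedin_def arrows_def[of G, symmetric])
qed

lemma algebraI: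
  assumes "\<And>\<sigma>. \<sigma> \<notin> arrows \<Sigma> \<Longrightarrow> f \<sigma> = 0" "locally_constant f" "contravariant f"
    and "compactin (gtop G) K" "suppG \<Sigma> q f \<subseteq> K"
  shows "f \<in> twisted_algebra"
proof -
  have "compactin (gtop G) (suppG \<Sigma> q f)"
    using closed_compactin assms(4,5) closedin_suppG[OF assms(2,3)] by metis
  moreover have "\<forall>\<sigma>. \<sigma> \<notin> arrows \<Sigma> \<longrightarrow> f \<sigma> = 0"
    using assms(1) by blast
  ultimately show ?thesis
    using assms(2,3) unfolding algebra_iff by (intro conjI)
qed

lemma zero_algebra: "(\<lambda>_. 0) \<in> twisted_algebra"
  by (rule algebraI[where K = "{}"]) (auto simp: contravariant_def suppG_def)

lemma diff_algebra:
  assumes "f \<in> twisted_algebra" "g \<in> twisted_algebra"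
  shows "(\<lambda>\<sigma>. f \<sigma> - g \<sigma>) \<in> twisted_algebra"
proof (rule algebraI)
  show "locally_constant (\<lambda>\<sigma>. f \<sigma> - g \<sigma>)"
    using assms by (intro continuous_map_discrete_combine[where c = "(-)"]) (simp_all add: algebra_iff)
  show "contravariant (\<lambda>\<sigma>. f \<sigma> - g \<sigma>)"
    using assms by (simp add: algebra_iff contravariant_def right_diff_distrib)
  show "compactin (gtop G) (suppG \<Sigma> q f \<union> suppG \<Sigma> q g)"
    using assms by (simp add: algebra_iff compactin_Un)
qed (use assms in \<open>auto simp: algebra_iff suppG_def\<close>)

text \<open>The support is covered by finitely many bisections, and each of them contains at most one arrow
  with a given range. Without this finiteness the convolution sum would be zero by convention.\<close>

lemma finite_fibre:
  assumes "f \<in> twisted_algebra"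
  shows "finite {\<alpha> \<in> suppG \<Sigma> q f. rng G \<alpha> = x}"
proof -
  have "compactin (gtop G) (suppG \<Sigma> q f)"
    using assms by (simp add: algebra_iff)
  moreover have "suppG \<Sigma> q f \<subseteq> \<Union> (Collect (open_bisection G))"
  proof
    fix \<alpha> assume "\<alpha> \<in> suppG \<Sigma> q f"
    then have "\<alpha> \<in> arrows G" by (auto simp: suppG_def)
    from DT2[OF this] show "\<alpha> \<in> \<Union> (Collect (open_bisection G))" by auto
  qed
  ultimately obtain \<F> where \<F>: "finite \<F>" "\<F> \<subseteq> Collect (open_bisection G)" "suppG \<Sigma> q f \<subseteq> \<Union> \<F>"
    using compactinD[of "gtop G" "suppG \<Sigma> q f" "Collect (open_bisection G)"] open_bisection_openin
    by auto
  have "finite (\<Union>B \<in> \<F>. rng G -` {x} \<inter> B)"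
    using \<F>(1,2) by (intro finite_UN_I finite_vimage_IntI open_bisection_inj) auto
  then show ?thesis
    by (rule rev_finite_subset) (use \<F>(3) in auto)
qed

text \<open>Locally constant functions that are constant on the fibres of \<open>q\<close> act on the algebra by pointwise
  multiplication. The relevant ones are functions of the range and of the source.\<close>

lemma mult_invariant_algebra:
  assumes f: "f \<in> twisted_algebra" and c: "locally_constant c"
    and inv: "\<And>t \<sigma>. t \<in> ring_units \<Longrightarrow> \<sigma> \<in> arrows \<Sigma> \<Longrightarrow> c (act t \<sigma>) = c \<sigma>"
  shows "(\<lambda>\<sigma>. c \<sigma> * f \<sigma>) \<in> twisted_algebra"
proof (rule algebraI)
  show "locally_constant (\<lambda>\<sigma>. c \<sigma> * f \<sigma>)"
    using f c by (intro continuous_map_discrete_combine[where c = "(*)"]) (simp_all add: algebra_iff)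
  show "contravariant (\<lambda>\<sigma>. c \<sigma> * f \<sigma>)"
    using f inv by (simp add: algebra_iff contravariant_def mult.left_commute)
  show "compactin (gtop G) (suppG \<Sigma> q f)" "\<And>\<sigma>. \<sigma> \<notin> arrows \<Sigma> \<Longrightarrow> c \<sigma> * f \<sigma> = 0"
    using f by (simp_all add: algebra_iff)
  show "suppG \<Sigma> q (\<lambda>\<sigma>. c \<sigma> * f \<sigma>) \<subseteq> suppG \<Sigma> q f"
    by (auto simp: suppG_def)
qed

text \<open>A function on the open subgroupoid remains locally constant when extended by zero, because its
  support in \<open>G\<close> is compact and therefore closed in all of \<open>G\<close>, not only in \<open>H\<close>.\<close>

lemma restricted_algebra_iff:
  assumes H: "openin (gtop G) H" and K: "K = {\<sigma> \<in> arrows \<Sigma>. q \<sigma> \<in> H}"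
  shows "f \<in> twisted_steinberg_algebra (restrict_groupoid G H) (restrict_groupoid \<Sigma> K) i q \<longleftrightarrow>
    f \<in> twisted_algebra \<and> (\<forall>\<sigma>. \<sigma> \<notin> K \<longrightarrow> f \<sigma> = 0)"
    (is "f \<in> ?AH \<longleftrightarrow> _")
proof -
  have oK: "openin (gtop \<Sigma>) K"
    unfolding K arrows_def by (rule openin_continuous_map_preimage[OF continuous_q H])
  have top: "topspace (subtopology (gtop \<Sigma>) K) = K"
    using openin_subset[OF oK] by auto
  have arr: "arrows (restrict_groupoid \<Sigma> K) = K"
    by (simp only: arrows_def gtop_restrict_groupoid top)
  have act: "twist_act (restrict_groupoid \<Sigma> K) i q = act"
    by (intro ext) (simp add: twist_act_def rng_def restrict_groupoid_def)
  have supp: "suppG (restrict_groupoid \<Sigma> K) q f = suppG \<Sigma> q f" if "\<forall>\<sigma>. \<sigma> \<notin> K \<longrightarrow> f \<sigma> = 0"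
    unfolding suppG_def arr using that by (auto simp: K)
  have AH: "f \<in> ?AH \<longleftrightarrow> (\<forall>\<sigma>. \<sigma> \<notin> K \<longrightarrow> f \<sigma> = 0) \<and>
      continuous_map (subtopology (gtop \<Sigma>) K) (discrete_topology UNIV) f \<and>
      (\<forall>t \<in> ring_units. \<forall>\<sigma> \<in> K. f (act t \<sigma>) = unit_inv t * f \<sigma>) \<and>
      compactin (subtopology (gtop G) H) (suppG (restrict_groupoid \<Sigma> K) q f)"
    by (simp only: twisted_steinberg_algebra_def mem_Collect_eq arr act
        continuous_map_discrete_iff_locally_constant gtop_restrict_groupoid top)
  show ?thesis
  proof
    assume f: "f \<in> ?AH"
    then have zero: "\<forall>\<sigma>. \<sigma> \<notin> K \<longrightarrow> f \<sigma> = 0"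
      and cont: "continuous_map (subtopology (gtop \<Sigma>) K) (discrete_topology UNIV) f"
      and contra: "\<forall>t \<in> ring_units. \<forall>\<sigma> \<in> K. f (act t \<sigma>) = unit_inv t * f \<sigma>"
      and cptH: "compactin (subtopology (gtop G) H) (suppG (restrict_groupoid \<Sigma> K) q f)"
      unfolding AH by - (elim conjE, assumption)+
    have cpt: "compactin (gtop G) (suppG \<Sigma> q f)" "suppG \<Sigma> q f \<subseteq> H"
      using cptH unfolding supp[OF zero] compactin_subtopology by simp_all
    have "locally_constant f"
    proof (rule continuous_map_discrete_local)
      fix \<sigma> assume \<sigma>: "\<sigma> \<in> topspace (gtop \<Sigma>)"
      show "\<exists>N. openin (gtop \<Sigma>) N \<and> \<sigma> \<in> N \<and>
          continuous_map (subtopology (gtop \<Sigma>) N) (discrete_topology UNIV) f"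
      proof (cases "\<sigma> \<in> K")
        case True
        then show ?thesis using cont oK by (intro exI[of _ K] conjI)
      next
        case False
        let ?N = "{\<tau> \<in> topspace (gtop \<Sigma>). q \<tau> \<in> topspace (gtop G) - suppG \<Sigma> q f}"
        have "openin (gtop G) (topspace (gtop G) - suppG \<Sigma> q f)"
          using compactin_imp_closedin[OF Hausdorff_G cpt(1)] by blast
        then have "openin (gtop \<Sigma>) ?N"
          by (rule openin_continuous_map_preimage[OF continuous_q])
        moreover have "\<sigma> \<in> ?N"
          using \<sigma> False cpt(2) continuous_map_funspace[OF continuous_q] by (auto simp: K arrows_def)
        moreover have "continuous_map (subtopology (gtop \<Sigma>) ?N) (discrete_topology UNIV) f"
          by (rule continuous_map_discrete_vanishing) (auto simp: suppG_def arrows_def)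
        ultimately show ?thesis by (intro exI conjI)
      qed
    qed
    moreover have "contravariant f"
      unfolding contravariant_def
    proof (intro ballI)
      fix t :: 'r and \<sigma> assume t: "t \<in> ring_units" and \<sigma>: "\<sigma> \<in> arrows \<Sigma>"
      show "f (act t \<sigma>) = unit_inv t * f \<sigma>"
      proof (cases "\<sigma> \<in> K")
        case True
        then show ?thesis using contra t by simp
      next
        case False
        then have "act t \<sigma> \<notin> K" using t \<sigma> by (simp add: K)
        then show ?thesis using False zero by simp
      qed
    qed
    moreover have "\<forall>\<sigma>. \<sigma> \<notin> arrows \<Sigma> \<longrightarrow> f \<sigma> = 0"
      using zero by (simp add: K)
    ultimately show "f \<in> twisted_algebra \<and> (\<forall>\<sigma>. \<sigma> \<notin> K \<longrightarrow> f \<sigma> = 0)"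
      using zero cpt(1) unfolding algebra_iff by (intro conjI)
  next
    assume f: "f \<in> twisted_algebra \<and> (\<forall>\<sigma>. \<sigma> \<notin> K \<longrightarrow> f \<sigma> = 0)"
    then have zero: "\<forall>\<sigma>. \<sigma> \<notin> K \<longrightarrow> f \<sigma> = 0" by (rule conjunct2)
    have "suppG \<Sigma> q f \<subseteq> H"
      using zero by (auto simp: suppG_def K)
    then show "f \<in> ?AH"
      using f unfolding AH supp[OF zero] compactin_subtopology algebra_iff contravariant_def
      by (auto simp: K intro: continuous_map_from_subtopology)
  qed
qed

text \<open>The substitute for the indicator function of a compact open bisection: in a local trivialisation
  \<open>B \<times> R\<^sup>\<times>\<close> it is \<open>(\<beta>, t) \<mapsto> t\<inverse>\<close> for \<open>\<beta>\<close> in a compact open set \<open>C \<subseteq> B\<close>, and zero elsewhere. The set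
  \<open>C\<close> is clopen, being compact and open in a Hausdorff space; hence the function is locally constant.\<close>

lemma exists_element_on_bisection:
  assumes \<alpha>: "\<alpha> \<in> arrows G" and W: "openin (gtop G) W" "\<alpha> \<in> W"
  obtains B P h where "open_bisection G B" "continuous_map (subtopology (gtop G) B) (gtop \<Sigma>) P"
    "\<And>\<beta>. \<beta> \<in> B \<Longrightarrow> q (P \<beta>) = \<beta>" "h \<in> twisted_algebra" "suppG \<Sigma> q h \<subseteq> B \<inter> W"
    "\<And>\<sigma>. \<sigma> \<in> arrows \<Sigma> \<Longrightarrow> q \<sigma> = \<alpha> \<Longrightarrow> h \<sigma> \<in> ring_units"
proof -
  from DT2[OF \<alpha>] obtain B P where B: "open_bisection G B" "\<alpha> \<in> B"
    and P: "continuous_map (subtopology (gtop G) B) (gtop \<Sigma>) P" "\<forall>\<beta> \<in> B. q (P \<beta>) = \<beta>"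
    and hom: "homeomorphic_map
      (prod_topology (subtopology (gtop G) B) (discrete_topology (ring_units :: 'r set)))
      (subtopology (gtop \<Sigma>) {\<sigma> \<in> arrows \<Sigma>. q \<sigma> \<in> B})
      (\<lambda>(\<beta>, t). i (rng G \<beta>, t) \<cdot>\<^bsub>\<Sigma>\<^esub> P \<beta>)"
      (is "homeomorphic_map ?X ?Y ?\<Phi>") by auto
  from hom obtain \<Psi> where \<Psi>: "homeomorphic_maps ?X ?Y ?\<Phi> \<Psi>"
    unfolding homeomorphic_map_maps ..
  have \<Psi>c: "continuous_map ?Y ?X \<Psi>" and \<Psi>\<Phi>: "\<And>z. z \<in> topspace ?X \<Longrightarrow> \<Psi> (?\<Phi> z) = z"
    and \<Phi>\<Psi>: "\<And>\<sigma>. \<sigma> \<in> topspace ?Y \<Longrightarrow> ?\<Phi> (\<Psi> \<sigma>) = \<sigma>"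
    using \<Psi> by (simp_all only: homeomorphic_maps_def)
  have oB: "openin (gtop G) B" by (rule open_bisection_openin[OF B(1)])
  have topX: "topspace ?X = B \<times> ring_units"
    using openin_subset[OF oB] by auto
  have topY: "topspace ?Y = {\<sigma> \<in> arrows \<Sigma>. q \<sigma> \<in> B}"
    by (auto simp: arrows_def)
  have oY: "openin (gtop \<Sigma>) {\<sigma> \<in> arrows \<Sigma>. q \<sigma> \<in> B}"
    unfolding arrows_def by (rule openin_continuous_map_preimage[OF continuous_q oB])
  have PA: "P \<beta> \<in> arrows \<Sigma>" if "\<beta> \<in> B" for \<beta>
    using that continuous_map_funspace[OF P(1)] openin_subset[OF oB] by (auto simp: arrows_def)
  have \<Phi>: "?\<Phi> (\<beta>, t) = act t (P \<beta>)" if "\<beta> \<in> B" for \<beta> t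
    using that P(2) PA by (simp add: twist_act_def)
  \<comment> \<open>The bisection provided by the twist need not be compact, so it is shrunk.\<close>
  obtain C where C: "compactin (gtop G) C" "openin (gtop G) C" "\<alpha> \<in> C" "C \<subseteq> B \<inter> W"
  proof -
    obtain \<B> where \<B>: "\<forall>B \<in> \<B>. compactin (gtop G) B \<and> open_bisection G B"
        "openin (gtop G) = arbitrary union_of (\<lambda>B. B \<in> \<B>)"
      using G.compact_open_bisection_basis by auto
    have "openin (gtop G) (B \<inter> W)" using oB W(1) by (rule openin_Int)
    then have "\<forall>x \<in> B \<inter> W. \<exists>U \<in> \<B>. x \<in> U \<and> U \<subseteq> B \<inter> W"
      unfolding \<B>(2) arbitrary_union_of_alt by blast
    from bspec[OF this IntI[OF B(2) W(2)]]
    obtain C where "C \<in> \<B>" "\<alpha> \<in> C" "C \<subseteq> B \<inter> W"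
      by (elim bexE conjE)
    with \<B>(1) show ?thesis
      by (intro that[of C]) (simp_all add: open_bisection_openin)
  qed
  \<comment> \<open>The second component of \<open>\<Psi>\<close> is the scalar \<open>t\<close> with \<open>\<sigma> = t \<cdot> P (q \<sigma>)\<close>.\<close>
  define h where "h \<sigma> = (if \<sigma> \<in> arrows \<Sigma> \<and> q \<sigma> \<in> C then unit_inv (snd (\<Psi> \<sigma>)) else 0)" for \<sigma>
  have \<Psi>_act: "snd (\<Psi> (act t \<sigma>)) = t * snd (\<Psi> \<sigma>)" "snd (\<Psi> \<sigma>) \<in> ring_units"
    if "\<sigma> \<in> arrows \<Sigma>" "q \<sigma> \<in> C" "t \<in> ring_units" for \<sigma> t
  proof -
    have \<sigma>: "\<sigma> \<in> topspace ?Y" unfolding topY using that C(4) by auto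
    then have "\<Psi> \<sigma> \<in> B \<times> ring_units"
      using funcset_mem[OF continuous_map_funspace[OF \<Psi>c] \<sigma>] by (simp only: topX)
    then obtain \<beta> s where \<beta>s: "\<Psi> \<sigma> = (\<beta>, s)" "\<beta> \<in> B" "s \<in> ring_units" by auto
    then have "\<sigma> = act s (P \<beta>)"
      using \<Phi>\<Psi>[OF \<sigma>] \<Phi>[OF \<beta>s(2), of s] by simp
    then have "act t \<sigma> = ?\<Phi> (\<beta>, t * s)"
      using \<Phi>[OF \<beta>s(2)] act_act[OF PA[OF \<beta>s(2)] that(3) \<beta>s(3)] by simp
    then have "\<Psi> (act t \<sigma>) = (\<beta>, t * s)"
      using \<Psi>\<Phi>[unfolded topX, of "(\<beta>, t * s)"] \<beta>s that(3) by (simp add: mult_ring_units)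
    then show "snd (\<Psi> (act t \<sigma>)) = t * snd (\<Psi> \<sigma>)" "snd (\<Psi> \<sigma>) \<in> ring_units"
      using \<beta>s by simp_all
  qed
  have supp: "suppG \<Sigma> q h \<subseteq> C"
    by (auto simp: suppG_def h_def split: if_splits)
  have "h \<in> twisted_algebra"
  proof (rule algebraI[OF _ _ _ C(1) supp])
    show "h \<sigma> = 0" if "\<sigma> \<notin> arrows \<Sigma>" for \<sigma>
      using that by (simp add: h_def)
    show "contravariant h"
      unfolding contravariant_def
    proof (intro ballI)
      fix t :: 'r and \<sigma> assume "t \<in> ring_units" "\<sigma> \<in> arrows \<Sigma>"
      then show "h (act t \<sigma>) = unit_inv t * h \<sigma>"
        using \<Psi>_act[of \<sigma> t] by (simp add: h_def unit_inv_mult)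
    qed
    show "locally_constant h"
    proof (rule continuous_map_discrete_local)
      fix \<sigma> assume \<sigma>: "\<sigma> \<in> topspace (gtop \<Sigma>)"
      show "\<exists>N. openin (gtop \<Sigma>) N \<and> \<sigma> \<in> N \<and>
          continuous_map (subtopology (gtop \<Sigma>) N) (discrete_topology UNIV) h"
      proof (cases "q \<sigma> \<in> C")
        case True
        let ?N = "{\<tau> \<in> topspace (gtop \<Sigma>). q \<tau> \<in> C}"
        have "continuous_map (prod_topology (subtopology (gtop G) B) (discrete_topology ring_units))
            (discrete_topology UNIV) (unit_inv \<circ> snd)"
          by (rule continuous_map_compose[OF continuous_map_snd]) simp
        from continuous_map_compose[OF \<Psi>c this]
        have "continuous_map ?Y (discrete_topology UNIV) (unit_inv \<circ> snd \<circ> \<Psi>)" .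
        then have "continuous_map (subtopology ?Y ?N) (discrete_topology UNIV) (unit_inv \<circ> snd \<circ> \<Psi>)"
          by (rule continuous_map_from_subtopology)
        also have "subtopology ?Y ?N = subtopology (gtop \<Sigma>) ?N"
          using C(4) unfolding subtopology_subtopology
          by (intro arg_cong[of _ _ "subtopology (gtop \<Sigma>)"]) (auto simp: arrows_def)
        finally have "continuous_map (subtopology (gtop \<Sigma>) ?N) (discrete_topology UNIV) h"
          by (rule continuous_map_eq) (simp add: h_def arrows_def)
        moreover have "openin (gtop \<Sigma>) ?N"
          by (rule openin_continuous_map_preimage[OF continuous_q C(2)])
        moreover have "\<sigma> \<in> ?N" using \<sigma> True by simp
        ultimately show ?thesis by (intro exI conjI)
      next
        case False
        let ?N = "{\<tau> \<in> topspace (gtop \<Sigma>). q \<tau> \<in> topspace (gtop G) - C}"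
        have "openin (gtop G) (topspace (gtop G) - C)"
          using compactin_imp_closedin[OF Hausdorff_G C(1)] by blast
        then have "openin (gtop \<Sigma>) ?N"
          by (rule openin_continuous_map_preimage[OF continuous_q])
        moreover have "\<sigma> \<in> ?N"
          using \<sigma> False continuous_map_funspace[OF continuous_q] by auto
        moreover have "continuous_map (subtopology (gtop \<Sigma>) ?N) (discrete_topology UNIV) h"
          by (rule continuous_map_discrete_vanishing) (simp add: h_def)
        ultimately show ?thesis by (intro exI conjI)
      qed
    qed
  qed
  moreover have "h \<sigma> \<in> ring_units" if "\<sigma> \<in> arrows \<Sigma>" "q \<sigma> = \<alpha>" for \<sigma>
    using that C(3) \<Psi>_act(2)[of \<sigma> 1] by (simp add: h_def unit_inv_ring_units one_ring_units)
  ultimately show ?thesis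
    using B P supp C(4) by (intro that[of B P h]) auto
qed

section \<open>Convolution\<close>

text \<open>Replacing a lift \<open>\<rho>\<close> by \<open>t \<cdot> \<rho>\<close> multiplies the first factor by \<open>t\<inverse>\<close> and, by centrality, the second
  one by \<open>t\<close>.\<close>

lemma section_independence:
  assumes f: "contravariant f" and g: "contravariant g"
    and arr: "\<rho> \<in> arrows \<Sigma>" "\<tau> \<in> arrows \<Sigma>" "\<sigma> \<in> arrows \<Sigma>"
    and eq: "q \<rho> = q \<tau>" "rng \<Sigma> \<rho> = rng \<Sigma> \<sigma>"
  shows "f \<tau> * g (ginv \<Sigma> \<tau> \<cdot>\<^bsub>\<Sigma>\<^esub> \<sigma>) = f \<rho> * g (ginv \<Sigma> \<rho> \<cdot>\<^bsub>\<Sigma>\<^esub> \<sigma>)"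
proof -
  obtain t where t: "t \<in> ring_units" "\<tau> = act t \<rho>"
    using fibre_act[OF arr(1,2) eq(1)] .
  have rng: "rng \<Sigma> \<tau> = rng \<Sigma> \<sigma>" using eq t arr by simp
  let ?b = "ginv \<Sigma> \<tau> \<cdot>\<^bsub>\<Sigma>\<^esub> \<sigma>"
  have comp: "(ginv \<Sigma> \<tau>, \<sigma>) \<in> composable \<Sigma>"
    using arr rng by (simp add: inv_composable)
  have b: "?b \<in> arrows \<Sigma>" "rng \<Sigma> ?b = src \<Sigma> \<tau>"
    using \<Sigma>.mult_closed[OF comp] \<Sigma>.rng_mult[OF comp] arr by simp_all
  have comp': "(\<rho>, ?b) \<in> composable \<Sigma>"
    using arr b t by (simp add: composable_def)
  have "\<rho> \<cdot>\<^bsub>\<Sigma>\<^esub> act t ?b = act t \<rho> \<cdot>\<^bsub>\<Sigma>\<^esub> ?b"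
    using mult_act[OF comp' t(1)] act_mult_left[OF comp' t(1)] by simp
  also have "\<dots> = \<sigma>"
    unfolding t(2)[symmetric] by (rule \<Sigma>.mult_inv_cancel[OF arr(2,3) rng])
  finally have "\<rho> \<cdot>\<^bsub>\<Sigma>\<^esub> act t ?b = \<sigma>" .
  moreover have "ginv \<Sigma> \<rho> \<cdot>\<^bsub>\<Sigma>\<^esub> (\<rho> \<cdot>\<^bsub>\<Sigma>\<^esub> act t ?b) = act t ?b"
    using arr b t comp' by (intro \<Sigma>.inv_mult_cancel) (simp_all add: composable_def)
  ultimately have "ginv \<Sigma> \<rho> \<cdot>\<^bsub>\<Sigma>\<^esub> \<sigma> = act t ?b"
    by simp
  then have "g (ginv \<Sigma> \<rho> \<cdot>\<^bsub>\<Sigma>\<^esub> \<sigma>) = unit_inv t * g ?b"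
    using g b t by (simp add: contravariant_def)
  moreover have "f \<tau> = unit_inv t * f \<rho>"
    using f arr t by (simp add: contravariant_def)
  ultimately show ?thesis
    by (simp only: mult_ac)
qed

text \<open>If \<open>q \<rho>\<close> lies outside the support of \<open>f\<close>, then the remaining sum is empty and both sides vanish.\<close>

lemma twisted_conv_single:
  assumes f: "contravariant f" and g: "contravariant g"
    and arr: "\<rho> \<in> arrows \<Sigma>" "\<sigma> \<in> arrows \<Sigma>" and rng: "rng \<Sigma> \<rho> = rng \<Sigma> \<sigma>"
    and fin: "finite {\<alpha> \<in> suppG \<Sigma> q f. rng G \<alpha> = rng G (q \<sigma>)}"
    and only: "\<And>\<alpha>. \<alpha> \<in> suppG \<Sigma> q f \<Longrightarrow> rng G \<alpha> = rng G (q \<sigma>) \<Longrightarrow>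
      ginv G \<alpha> \<cdot>\<^bsub>G\<^esub> q \<sigma> \<in> suppG \<Sigma> q g \<Longrightarrow> \<alpha> = q \<rho>"
  shows "twisted_conv G \<Sigma> q f g \<sigma> = f \<rho> * g (ginv \<Sigma> \<rho> \<cdot>\<^bsub>\<Sigma>\<^esub> \<sigma>)"
proof -
  let ?I = "{\<alpha> \<in> suppG \<Sigma> q f. rng G \<alpha> = rng G (q \<sigma>)}"
  let ?S = "inv_into (arrows \<Sigma>) q"
  let ?v = "f \<rho> * g (ginv \<Sigma> \<rho> \<cdot>\<^bsub>\<Sigma>\<^esub> \<sigma>)"
  have S: "?S \<alpha> \<in> arrows \<Sigma>" "q (?S \<alpha>) = \<alpha>" if "\<alpha> \<in> ?I" for \<alpha>
  proof -
    have "\<alpha> \<in> q ` arrows \<Sigma>" using that by (auto simp: suppG_def)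
    then show "?S \<alpha> \<in> arrows \<Sigma>" "q (?S \<alpha>) = \<alpha>"
      by (rule inv_into_into, rule f_inv_into_f)
  qed
  have summand: "f (?S \<alpha>) * g (ginv \<Sigma> (?S \<alpha>) \<cdot>\<^bsub>\<Sigma>\<^esub> \<sigma>) = (if \<alpha> = q \<rho> then ?v else 0)" if \<alpha>: "\<alpha> \<in> ?I" for \<alpha>
  proof (cases "\<alpha> = q \<rho>")
    case True
    then show ?thesis
      using section_independence[OF f g arr(1) S(1)[OF \<alpha>] arr(2) _ rng] S(2)[OF \<alpha>] by simp
  next
    case False
    have comp: "(ginv \<Sigma> (?S \<alpha>), \<sigma>) \<in> composable \<Sigma>"
      using S[OF \<alpha>] \<alpha> arr(2) by (intro inv_composable) (simp_all add: rng_eq_iff)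
    then have "q (ginv \<Sigma> (?S \<alpha>) \<cdot>\<^bsub>\<Sigma>\<^esub> \<sigma>) = ginv G \<alpha> \<cdot>\<^bsub>G\<^esub> q \<sigma>"
      using S[OF \<alpha>] by (simp add: q_mult)
    then have "g (ginv \<Sigma> (?S \<alpha>) \<cdot>\<^bsub>\<Sigma>\<^esub> \<sigma>) = 0"
      using in_suppG_iff[OF g \<Sigma>.mult_closed[OF comp]] only[of \<alpha>] \<alpha> False by auto
    then show ?thesis using False by simp
  qed
  have "twisted_conv G \<Sigma> q f g \<sigma> = (\<Sum>\<alpha> \<in> ?I. f (?S \<alpha>) * g (ginv \<Sigma> (?S \<alpha>) \<cdot>\<^bsub>\<Sigma>\<^esub> \<sigma>))"
    by (simp add: twisted_conv_def Let_def arr(2))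
  also have "\<dots> = (\<Sum>\<alpha> \<in> ?I. if \<alpha> = q \<rho> then ?v else 0)"
    by (rule sum.cong[OF refl summand])
  also have "\<dots> = (if q \<rho> \<in> ?I then ?v else 0)"
    using fin by (simp add: sum.delta)
  also have "\<dots> = ?v"
    using in_suppG_iff[OF f arr(1)] rng rng_eq_iff[OF arr] by simp
  finally show ?thesis .
qed

text \<open>Over a given range there is just one unit, and the range of \<open>\<sigma>\<close> in \<open>\<Sigma>\<close> is a lift of it.\<close>

lemma conv_units_left:
  assumes h: "h \<in> twisted_algebra" and f: "f \<in> twisted_algebra" and supp: "suppG \<Sigma> q h \<subseteq> units G"
  shows "twisted_conv G \<Sigma> q h f = (\<lambda>\<sigma>. h (rng \<Sigma> \<sigma>) * f \<sigma>)"
proof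
  fix \<sigma>
  show "twisted_conv G \<Sigma> q h f \<sigma> = h (rng \<Sigma> \<sigma>) * f \<sigma>"
  proof (cases "\<sigma> \<in> arrows \<Sigma>")
    case True
    have "twisted_conv G \<Sigma> q h f \<sigma> = h (rng \<Sigma> \<sigma>) * f (ginv \<Sigma> (rng \<Sigma> \<sigma>) \<cdot>\<^bsub>\<Sigma>\<^esub> \<sigma>)"
      using h f True supp
      by (intro twisted_conv_single finite_fibre) (auto simp: algebra_iff G.units_iff dest!: subsetD[OF supp])
    also have "ginv \<Sigma> (rng \<Sigma> \<sigma>) \<cdot>\<^bsub>\<Sigma>\<^esub> \<sigma> = \<sigma>"
      using \<Sigma>.inv_mult_cancel[of "rng \<Sigma> \<sigma>" \<sigma>] True by (simp add: \<Sigma>.rng_left)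
    finally show ?thesis .
  next
    case False
    then show ?thesis using f by (simp add: twisted_conv_def algebra_iff)
  qed
qed

text \<open>Only the arrow \<open>\<alpha> = q \<sigma>\<close> makes \<open>\<alpha>\<inverse> (q \<sigma>)\<close> a unit, and \<open>\<sigma>\<close> itself is a lift of it.\<close>

lemma conv_units_right:
  assumes f: "f \<in> twisted_algebra" and h: "h \<in> twisted_algebra" and supp: "suppG \<Sigma> q h \<subseteq> units G"
  shows "twisted_conv G \<Sigma> q f h = (\<lambda>\<sigma>. h (src \<Sigma> \<sigma>) * f \<sigma>)"
proof
  fix \<sigma>
  show "twisted_conv G \<Sigma> q f h \<sigma> = h (src \<Sigma> \<sigma>) * f \<sigma>"
  proof (cases "\<sigma> \<in> arrows \<Sigma>")
    case True
    have "twisted_conv G \<Sigma> q f h \<sigma> = f \<sigma> * h (ginv \<Sigma> \<sigma> \<cdot>\<^bsub>\<Sigma>\<^esub> \<sigma>)"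
    proof (rule twisted_conv_single)
      fix \<alpha> assume \<alpha>: "\<alpha> \<in> suppG \<Sigma> q f" "rng G \<alpha> = rng G (q \<sigma>)"
        "ginv G \<alpha> \<cdot>\<^bsub>G\<^esub> q \<sigma> \<in> suppG \<Sigma> q h"
      then have "\<alpha> \<in> arrows G" by (auto simp: suppG_def)
      then show "\<alpha> = q \<sigma>"
        using G.unit_of_inv_mult_unit[OF _ q_closed[OF True] \<alpha>(2) subsetD[OF supp \<alpha>(3)]] by simp
    qed (use f h True finite_fibre[OF f] in \<open>simp_all add: algebra_iff\<close>)
    then show ?thesis by (simp only: src_def mult.commute)
  next
    case False
    then show ?thesis using f by (simp add: twisted_conv_def algebra_iff)
  qed
qed

lemma conv_units_left_algebra:
  assumes "h \<in> twisted_algebra" "f \<in> twisted_algebra" "suppG \<Sigma> q h \<subseteq> units G"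
  shows "twisted_conv G \<Sigma> q h f \<in> twisted_algebra"
  unfolding conv_units_left[OF assms]
  using continuous_map_compose[OF \<Sigma>.continuous_rng, of _ h] assms
  by (intro mult_invariant_algebra) (simp_all add: algebra_iff o_def)

lemma conv_units_right_algebra:
  assumes "f \<in> twisted_algebra" "h \<in> twisted_algebra" "suppG \<Sigma> q h \<subseteq> units G"
  shows "twisted_conv G \<Sigma> q f h \<in> twisted_algebra"
  unfolding conv_units_right[OF assms]
  using continuous_map_compose[OF \<Sigma>.continuous_src, of _ h] assms
  by (intro mult_invariant_algebra) (simp_all add: algebra_iff o_def)

text \<open>A bisection contains at most one arrow of given range, so convolution with \<open>h\<close> is a weighted
  translation.\<close>

lemma conv_bisection:
  assumes h: "h \<in> twisted_algebra" and f: "f \<in> twisted_algebra"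
    and B: "open_bisection G B" "suppG \<Sigma> q h \<subseteq> B"
    and arr: "\<rho> \<in> arrows \<Sigma>" "\<sigma> \<in> arrows \<Sigma>" and rng: "rng \<Sigma> \<rho> = rng \<Sigma> \<sigma>" and \<rho>: "q \<rho> \<in> B"
  shows "twisted_conv G \<Sigma> q h f \<sigma> = h \<rho> * f (ginv \<Sigma> \<rho> \<cdot>\<^bsub>\<Sigma>\<^esub> \<sigma>)"
proof (rule twisted_conv_single)
  fix \<alpha> assume \<alpha>: "\<alpha> \<in> suppG \<Sigma> q h" "rng G \<alpha> = rng G (q \<sigma>)"
  then show "\<alpha> = q \<rho>"
    using inj_onD[OF open_bisection_inj[OF B(1)], of \<alpha> "q \<rho>"] B(2) \<rho> rng rng_eq_iff[OF arr] by auto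
qed (use h f arr rng finite_fibre[OF h] in \<open>simp_all add: algebra_iff\<close>)

lemma conv_zero:
  assumes "rng G (q \<sigma>) \<notin> rng G ` suppG \<Sigma> q h"
  shows "twisted_conv G \<Sigma> q h f \<sigma> = 0"
proof -
  have "{\<alpha> \<in> suppG \<Sigma> q h. rng G \<alpha> = rng G (q \<sigma>)} = {}"
    using assms by (metis (mono_tags, lifting) Collect_empty_eq imageI)
  then show ?thesis
    by (simp only: twisted_conv_def Let_def sum.empty if_cancel)
qed

text \<open>The translation formula is applied with a lift that depends continuously on \<open>\<sigma>\<close>: first the arrow of
  \<open>B\<close> that has the range of \<open>q \<sigma>\<close>, then its image under the section \<open>P\<close>. This proves local constancy
  where the range lies in \<open>r(B)\<close>; elsewhere the function vanishes on a neighbourhood, as the range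
  of the compact support of \<open>h\<close> is closed. The support lies in the product of the two
  supports, which is compact.\<close>

lemma conv_bisection_algebra:
  assumes h: "h \<in> twisted_algebra" and f: "f \<in> twisted_algebra"
    and B: "open_bisection G B" "suppG \<Sigma> q h \<subseteq> B"
    and P: "continuous_map (subtopology (gtop G) B) (gtop \<Sigma>) P" "\<And>\<beta>. \<beta> \<in> B \<Longrightarrow> q (P \<beta>) = \<beta>"
  shows "twisted_conv G \<Sigma> q h f \<in> twisted_algebra"
proof (rule algebraI)
  let ?F = "twisted_conv G \<Sigma> q h f"
  let ?D = "rng G ` suppG \<Sigma> q h"
  note F = conv_bisection[OF h f B]
  have hf: "contravariant h" "contravariant f" "locally_constant h" "locally_constant f"
    and cpt: "compactin (gtop G) (suppG \<Sigma> q h)" "compactin (gtop G) (suppG \<Sigma> q f)"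
    using h f by (simp_all add: algebra_iff)
  have nz: "\<exists>\<rho>. \<rho> \<in> arrows \<Sigma> \<and> q \<rho> \<in> suppG \<Sigma> q h \<and> rng \<Sigma> \<rho> = rng \<Sigma> \<sigma>"
    if "\<sigma> \<in> arrows \<Sigma>" "rng G (q \<sigma>) \<in> ?D" for \<sigma>
  proof -
    from that(2) obtain \<beta> where \<beta>: "rng G (q \<sigma>) = rng G \<beta>" "\<beta> \<in> suppG \<Sigma> q h"
      by (rule imageE)
    then have "\<beta> \<in> arrows G" by (auto simp: suppG_def)
    then obtain \<rho> where "\<rho> \<in> arrows \<Sigma>" "q \<rho> = \<beta>" using q_lift by metis
    then show ?thesis using \<beta> rng_eq_iff[of \<rho> \<sigma>] that(1) by auto
  qed
  show "?F \<sigma> = 0" if "\<sigma> \<notin> arrows \<Sigma>" for \<sigma>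
    using that by (simp add: twisted_conv_def)
  show "contravariant ?F"
    unfolding contravariant_def
  proof (intro ballI)
    fix t :: 'r and \<sigma> assume t: "t \<in> ring_units" and \<sigma>: "\<sigma> \<in> arrows \<Sigma>"
    show "?F (act t \<sigma>) = unit_inv t * ?F \<sigma>"
    proof (cases "rng G (q \<sigma>) \<in> ?D")
      case True
      from nz[OF \<sigma> this] obtain \<rho> where
        \<rho>: "\<rho> \<in> arrows \<Sigma>" "q \<rho> \<in> suppG \<Sigma> q h" "rng \<Sigma> \<rho> = rng \<Sigma> \<sigma>" by auto
      have comp: "(ginv \<Sigma> \<rho>, \<sigma>) \<in> composable \<Sigma>"
        using \<rho> \<sigma> by (simp add: inv_composable)
      have "?F (act t \<sigma>) = h \<rho> * f (act t (ginv \<Sigma> \<rho> \<cdot>\<^bsub>\<Sigma>\<^esub> \<sigma>))"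
        using F[of \<rho> "act t \<sigma>"] \<rho> \<sigma> t B(2) mult_act[OF comp t] by auto
      also have "\<dots> = h \<rho> * (unit_inv t * f (ginv \<Sigma> \<rho> \<cdot>\<^bsub>\<Sigma>\<^esub> \<sigma>))"
        using hf(2) t \<Sigma>.mult_closed[OF comp] by (simp add: contravariant_def)
      also have "\<dots> = unit_inv t * ?F \<sigma>"
        using F[of \<rho> \<sigma>] \<rho> \<sigma> B(2) by (auto simp: mult.left_commute)
      finally show ?thesis .
    next
      case False
      then show ?thesis using \<sigma> t by (simp add: conv_zero)
    qed
  qed
  show "compactin (gtop G) ((\<lambda>(a, b). a \<cdot>\<^bsub>G\<^esub> b) ` (composable G \<inter> suppG \<Sigma> q h \<times> suppG \<Sigma> q f))"
    by (rule G.compactin_mult[OF Hausdorff_G cpt])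
  show "suppG \<Sigma> q ?F \<subseteq> (\<lambda>(a, b). a \<cdot>\<^bsub>G\<^esub> b) ` (composable G \<inter> suppG \<Sigma> q h \<times> suppG \<Sigma> q f)"
  proof
    fix \<alpha> assume "\<alpha> \<in> suppG \<Sigma> q ?F"
    then obtain \<sigma> where \<sigma>: "\<sigma> \<in> arrows \<Sigma>" "?F \<sigma> \<noteq> 0" "\<alpha> = q \<sigma>"
      by (auto simp: suppG_def)
    then have "rng G (q \<sigma>) \<in> ?D"
      using conv_zero by metis
    from nz[OF \<sigma>(1) this] obtain \<rho> where
      \<rho>: "\<rho> \<in> arrows \<Sigma>" "q \<rho> \<in> suppG \<Sigma> q h" "rng \<Sigma> \<rho> = rng \<Sigma> \<sigma>" by auto
    have comp: "(ginv \<Sigma> \<rho>, \<sigma>) \<in> composable \<Sigma>"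
      using \<rho> \<sigma> by (simp add: inv_composable)
    let ?\<tau> = "ginv \<Sigma> \<rho> \<cdot>\<^bsub>\<Sigma>\<^esub> \<sigma>"
    have \<tau>: "?\<tau> \<in> arrows \<Sigma>" "rng \<Sigma> ?\<tau> = src \<Sigma> \<rho>"
      using \<Sigma>.mult_closed[OF comp] \<Sigma>.rng_mult[OF comp] \<rho> by simp_all
    have "f ?\<tau> \<noteq> 0"
      using F[of \<rho> \<sigma>] \<rho> \<sigma> B(2) by auto
    then have "q ?\<tau> \<in> suppG \<Sigma> q f"
      using in_suppG_iff[OF hf(2) \<tau>(1)] by simp
    moreover have comp': "(\<rho>, ?\<tau>) \<in> composable \<Sigma>"
      using \<rho> \<tau> by (simp add: composable_def)
    have "(q \<rho>, q ?\<tau>) \<in> composable G"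
      using comp' hom_q by (auto simp: groupoid_hom_def)
    moreover have "\<alpha> = q \<rho> \<cdot>\<^bsub>G\<^esub> q ?\<tau>"
      using q_mult[OF comp'] \<Sigma>.mult_inv_cancel[OF \<rho>(1) \<sigma>(1) \<rho>(3)] \<sigma>(3) by simp
    ultimately show "\<alpha> \<in> (\<lambda>(a, b). a \<cdot>\<^bsub>G\<^esub> b) ` (composable G \<inter> suppG \<Sigma> q h \<times> suppG \<Sigma> q f)"
      using \<rho>(2) by (intro image_eqI[where x = "(q \<rho>, q ?\<tau>)"]) simp_all
  qed
  have rq: "continuous_map (gtop \<Sigma>) (unit_top G) (rng G \<circ> q)"
    by (rule continuous_map_compose[OF continuous_q G.continuous_rng_units])
  show "locally_constant ?F"
  proof (rule continuous_map_discrete_local)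
    fix \<sigma> assume \<sigma>: "\<sigma> \<in> topspace (gtop \<Sigma>)"
    show "\<exists>N. openin (gtop \<Sigma>) N \<and> \<sigma> \<in> N \<and>
        continuous_map (subtopology (gtop \<Sigma>) N) (discrete_topology UNIV) ?F"
    proof (cases "rng G (q \<sigma>) \<in> rng G ` B")
      case False
      let ?N = "{\<tau> \<in> topspace (gtop \<Sigma>). (rng G \<circ> q) \<tau> \<in> topspace (unit_top G) - ?D}"
      have "compactin (gtop G) ?D"
        using cpt(1) G.continuous_rng by (rule image_compactin)
      then have "closedin (gtop G) ?D"
        by (rule compactin_imp_closedin[OF Hausdorff_G])
      moreover have "?D \<subseteq> units G"
        by (auto simp: suppG_def)
      ultimately have "closedin (unit_top G) ?D"
        by (simp add: unit_top_def closedin_closed_subtopology closedin_subset_topspace)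
      then have "openin (gtop \<Sigma>) ?N"
        by (intro openin_continuous_map_preimage[OF rq]) blast
      moreover have "\<sigma> \<in> ?N"
        using \<sigma> False B(2) continuous_map_funspace[OF rq] by auto
      moreover have "continuous_map (subtopology (gtop \<Sigma>) ?N) (discrete_topology UNIV) ?F"
        by (rule continuous_map_discrete_vanishing) (simp add: conv_zero)
      ultimately show ?thesis by (intro exI conjI)
    next
      case True
      have hom: "homeomorphic_map (subtopology (gtop G) B) (subtopology (unit_top G) (rng G ` B)) (rng G)"
        and oV: "openin (unit_top G) (rng G ` B)"
        using B(1) by (simp_all add: open_bisection_def)
      from hom obtain b where b: "homeomorphic_maps (subtopology (gtop G) B)
          (subtopology (unit_top G) (rng G ` B)) (rng G) b"
        unfolding homeomorphic_map_maps ..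
      let ?N = "{\<tau> \<in> topspace (gtop \<Sigma>). (rng G \<circ> q) \<tau> \<in> rng G ` B}"
      let ?Y = "subtopology (gtop \<Sigma>) ?N"
      define p where "p = P \<circ> (b \<circ> (rng G \<circ> q))"
      have oN: "openin (gtop \<Sigma>) ?N"
        by (rule openin_continuous_map_preimage[OF rq oV])
      have topY: "topspace ?Y = ?N" by auto
      have "continuous_map ?Y (subtopology (unit_top G) (rng G ` B)) (rng G \<circ> q)"
        by (intro continuous_map_into_subtopology continuous_map_from_subtopology rq) auto
      moreover have "continuous_map (subtopology (unit_top G) (rng G ` B)) (subtopology (gtop G) B) b"
        using b by (simp only: homeomorphic_maps_def)
      ultimately have bc: "continuous_map ?Y (subtopology (gtop G) B) (b \<circ> (rng G \<circ> q))"
        by (rule continuous_map_compose)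
      then have pc: "continuous_map ?Y (gtop \<Sigma>) p"
        unfolding p_def by (rule continuous_map_compose[OF _ P(1)])
      have pB: "p \<tau> \<in> arrows \<Sigma>" "q (p \<tau>) \<in> B" "rng \<Sigma> (p \<tau>) = rng \<Sigma> \<tau>" if "\<tau> \<in> ?N" for \<tau>
      proof -
        have \<tau>: "\<tau> \<in> topspace ?Y" using that by (simp only: topY)
        let ?\<beta> = "b (rng G (q \<tau>))"
        have \<beta>: "?\<beta> \<in> B"
          using funcset_mem[OF continuous_map_funspace[OF bc] \<tau>] by simp
        show p: "p \<tau> \<in> arrows \<Sigma>"
          using funcset_mem[OF continuous_map_funspace[OF pc] \<tau>] by (simp add: arrows_def)
        show "q (p \<tau>) \<in> B"
          using P(2)[OF \<beta>] \<beta> by (simp add: p_def)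
        have "rng G (q \<tau>) \<in> topspace (subtopology (unit_top G) (rng G ` B))"
          using that openin_subset[OF oV] by auto
        then have "rng G ?\<beta> = rng G (q \<tau>)"
          using b by (simp only: homeomorphic_maps_def)
        then show "rng \<Sigma> (p \<tau>) = rng \<Sigma> \<tau>"
          using P(2)[OF \<beta>] p that rng_eq_iff[of "p \<tau>" \<tau>] by (simp add: p_def arrows_def)
      qed
      have inv: "continuous_map ?Y (gtop \<Sigma>) (\<lambda>\<tau>. ginv \<Sigma> (p \<tau>))"
        using continuous_map_compose[OF pc \<Sigma>.continuous_inv] by (simp add: o_def)
      have "continuous_map ?Y (prod_topology (gtop \<Sigma>) (gtop \<Sigma>)) (\<lambda>\<tau>. (ginv \<Sigma> (p \<tau>), \<tau>))"
        by (intro continuous_map_pairedI inv continuous_map_from_subtopology) simp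
      then have "continuous_map ?Y (subtopology (prod_topology (gtop \<Sigma>) (gtop \<Sigma>)) (composable \<Sigma>))
          (\<lambda>\<tau>. (ginv \<Sigma> (p \<tau>), \<tau>))"
        using pB by (intro continuous_map_into_subtopology) (auto simp: inv_composable arrows_def)
      from continuous_map_compose[OF this \<Sigma>.continuous_mult]
      have m: "continuous_map ?Y (gtop \<Sigma>) (\<lambda>\<tau>. ginv \<Sigma> (p \<tau>) \<cdot>\<^bsub>\<Sigma>\<^esub> \<tau>)"
        by (simp add: o_def)
      have "continuous_map ?Y (discrete_topology UNIV) (\<lambda>\<tau>. h (p \<tau>) * f (ginv \<Sigma> (p \<tau>) \<cdot>\<^bsub>\<Sigma>\<^esub> \<tau>))"
        using continuous_map_compose[OF pc hf(3)] continuous_map_compose[OF m hf(4)]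
        by (intro continuous_map_discrete_combine[where c = "(*)"]) (simp_all add: o_def)
      then have "continuous_map ?Y (discrete_topology UNIV) ?F"
      proof (rule continuous_map_eq)
        fix \<tau> assume "\<tau> \<in> topspace ?Y"
        then have \<tau>: "\<tau> \<in> ?N" by (simp only: topY)
        then have "\<tau> \<in> arrows \<Sigma>" by (simp add: arrows_def)
        then show "h (p \<tau>) * f (ginv \<Sigma> (p \<tau>) \<cdot>\<^bsub>\<Sigma>\<^esub> \<tau>) = ?F \<tau>"
          using F[OF pB(1)[OF \<tau>] _ pB(3)[OF \<tau>] pB(2)[OF \<tau>]] by simp
      qed
      moreover have "\<sigma> \<in> ?N" using \<sigma> True by simp
      ultimately show ?thesis using oN by (intro exI conjI)
    qed
  qed
qed

section \<open>Compression to the interior of the isotropy\<close>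

text \<open>The core of the argument, for any set that absorbs convolution from both sides, such as the
  kernel of a homomorphism: translate a nonzero element so that it becomes nonzero on a unit, and
  then compress it to a small neighbourhood of a unit with isotropy in the interior.\<close>

lemma nonzero_on_isotropy_in_absorbing_set:
  assumes dense: "unit_top \<Sigma> closure_of {u \<in> units \<Sigma>. isotropy \<Sigma> u \<subseteq> Iso_interior \<Sigma>} = units \<Sigma>"
    and absorb_left: "\<And>f h. f \<in> I \<Longrightarrow> f \<in> twisted_algebra \<Longrightarrow> h \<in> twisted_algebra \<Longrightarrow>
      twisted_conv G \<Sigma> q h f \<in> I"
    and absorb_right: "\<And>f h. f \<in> I \<Longrightarrow> f \<in> twisted_algebra \<Longrightarrow> h \<in> twisted_algebra \<Longrightarrow>
      twisted_conv G \<Sigma> q f h \<in> I"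
    and f: "f \<in> I" "f \<in> twisted_algebra" "f \<noteq> (\<lambda>_. 0)"
  obtains g where "g \<in> I" "g \<in> twisted_algebra" "g \<noteq> (\<lambda>_. 0)" "\<forall>\<sigma>. \<sigma> \<notin> Iso_interior \<Sigma> \<longrightarrow> g \<sigma> = 0"
proof -
  obtain \<sigma>0 where \<sigma>0: "f \<sigma>0 \<noteq> 0" "\<sigma>0 \<in> arrows \<Sigma>"
    using f(2,3) by (auto simp: algebra_iff)
  have "ginv G (q \<sigma>0) \<in> arrows G" using \<sigma>0 by (simp add: G.inv_closed)
  from exists_element_on_bisection[OF this openin_topspace] obtain B P h where
    B: "open_bisection G B" and P: "continuous_map (subtopology (gtop G) B) (gtop \<Sigma>) P"
      "\<And>\<beta>. \<beta> \<in> B \<Longrightarrow> q (P \<beta>) = \<beta>"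
    and h: "h \<in> twisted_algebra" "suppG \<Sigma> q h \<subseteq> B \<inter> topspace (gtop G)"
      "\<And>\<sigma>. \<sigma> \<in> arrows \<Sigma> \<Longrightarrow> q \<sigma> = ginv G (q \<sigma>0) \<Longrightarrow> h \<sigma> \<in> ring_units"
    using \<open>ginv G (q \<sigma>0) \<in> arrows G\<close> unfolding arrows_def by metis
  have hB: "suppG \<Sigma> q h \<subseteq> B" using h(2) by simp
  \<comment> \<open>At \<open>\<sigma>0\<inverse> \<sigma>0\<close> the translate \<open>F\<close> has the value of \<open>f\<close> at \<open>\<sigma>0\<close>, up to a unit of the ring.\<close>
  define F where "F = twisted_conv G \<Sigma> q h f"
  have FA: "F \<in> twisted_algebra" and FI: "F \<in> I"
    unfolding F_def using conv_bisection_algebra[OF h(1) f(2) B hB P] absorb_left[OF f(1,2) h(1)] by simp_all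
  let ?u0 = "src \<Sigma> \<sigma>0"
  have inv0: "ginv \<Sigma> \<sigma>0 \<in> arrows \<Sigma>" using \<sigma>0 by (simp add: \<Sigma>.inv_closed)
  have nz: "h (ginv \<Sigma> \<sigma>0) * f \<sigma>0 \<noteq> 0"
    using \<sigma>0 h(3)[OF inv0] by (simp add: ring_unit_mult_eq_0_iff)
  then have "q (ginv \<Sigma> \<sigma>0) \<in> suppG \<Sigma> q h"
    using in_suppG_iff[of h, OF _ inv0] h(1) by (auto simp: algebra_iff)
  then have "q (ginv \<Sigma> \<sigma>0) \<in> B" using hB by (rule subsetD[rotated])
  then have "F ?u0 = h (ginv \<Sigma> \<sigma>0) * f (ginv \<Sigma> (ginv \<Sigma> \<sigma>0) \<cdot>\<^bsub>\<Sigma>\<^esub> ?u0)"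
    unfolding F_def using inv0 \<sigma>0 by (intro conv_bisection[OF h(1) f(2) B hB]) simp_all
  then have F0: "F ?u0 \<noteq> 0"
    using nz \<sigma>0 by (simp add: \<Sigma>.inv_inv \<Sigma>.src_right)
  have "\<exists>W. openin (gtop \<Sigma>) W \<and> ?u0 \<in> W \<and> (\<forall>\<tau> \<in> W. F \<tau> = F ?u0)"
    using FA \<sigma>0(2) unfolding algebra_iff continuous_map_discrete_iff_locally_constant
    by (simp add: arrows_def[symmetric])
  then obtain W where W: "openin (gtop \<Sigma>) W" "?u0 \<in> W" "\<forall>\<tau> \<in> W. F \<tau> = F ?u0" by (elim exE conjE)
  have "?u0 \<in> unit_top \<Sigma> closure_of {u \<in> units \<Sigma>. isotropy \<Sigma> u \<subseteq> Iso_interior \<Sigma>}"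
    unfolding dense using \<sigma>0(2) by simp
  moreover have "openin (unit_top \<Sigma>) (W \<inter> units \<Sigma>)"
    unfolding unit_top_def using W(1) by (rule openin_subtopology_Int)
  moreover have "?u0 \<in> W \<inter> units \<Sigma>" using W(2) \<sigma>0(2) by simp
  ultimately obtain u where u: "u \<in> units \<Sigma>" "isotropy \<Sigma> u \<subseteq> Iso_interior \<Sigma>" "u \<in> W"
    unfolding in_closure_of by auto
  have Fu: "F u \<noteq> 0" using W(3) u(3) F0 by metis
  have u_arr: "u \<in> arrows \<Sigma>" "rng \<Sigma> u = u" "src \<Sigma> u = u"
    using u(1) by (simp_all add: \<Sigma>.units_iff \<Sigma>.unit_src)
  let ?x = "q u"
  have x: "?x \<in> arrows G" "?x \<in> units G"
    using u_arr q_rng[of u] by (simp_all add: G.units_iff)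

  let ?X = "prod_topology (gtop G) (gtop G)"
  \<comment> \<open>The pairs of endpoints that the compression has to avoid.\<close>
  define C where "C = (\<lambda>\<alpha>. (rng G \<alpha>, src G \<alpha>)) ` ((topspace (gtop G) - Iso_interior G) \<inter> suppG \<Sigma> q F)"
  have "compactin ?X C"
    unfolding C_def
  proof (rule image_compactin)
    show "compactin (gtop G) ((topspace (gtop G) - Iso_interior G) \<inter> suppG \<Sigma> q F)"
      using FA by (intro closed_Int_compactin closedin_diff closedin_topspace) (simp_all add: algebra_iff Iso_interior_def)
    show "continuous_map (gtop G) ?X (\<lambda>\<alpha>. (rng G \<alpha>, src G \<alpha>))"
      by (intro continuous_map_pairedI G.continuous_rng G.continuous_src)
  qed
  then have "closedin ?X C"
    using Hausdorff_G by (intro compactin_imp_closedin) (simp_all add: Hausdorff_space_prod_topology)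
  then have oC: "openin ?X (topspace ?X - C)" by blast
  \<comment> \<open>An arrow of \<open>G\<close> from \<open>q u\<close> to \<open>q u\<close> lifts to the isotropy group of \<open>u\<close>, which lies in the interior.\<close>
  have "(?x, ?x) \<notin> C"
  proof
    assume "(?x, ?x) \<in> C"
    then obtain \<alpha> where \<alpha>: "rng G \<alpha> = ?x" "src G \<alpha> = ?x" "\<alpha> \<notin> Iso_interior G" "\<alpha> \<in> suppG \<Sigma> q F"
      by (auto simp: C_def)
    then obtain \<sigma> where \<sigma>: "\<sigma> \<in> arrows \<Sigma>" "q \<sigma> = \<alpha>" by (auto simp: suppG_def)
    then have "rng \<Sigma> \<sigma> = u" "src \<Sigma> \<sigma> = u"
      using \<alpha>(1,2) u(1) by (auto intro: q_inj_units)
    then have "\<sigma> \<in> isotropy \<Sigma> u"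
      using \<sigma>(1) by (simp add: isotropy_def)
    then show False
      using u(2) \<sigma>(2) \<alpha>(3) by (auto simp: Iso_interior_eq)
  qed
  then have "(?x, ?x) \<in> topspace ?X - C"
    using x(1) by (simp add: arrows_def)
  with oC obtain U V where UV: "openin (gtop G) U" "openin (gtop G) V" "?x \<in> U" "?x \<in> V"
      "U \<times> V \<subseteq> topspace ?X - C"
    unfolding openin_prod_topology_alt by metis
  \<comment> \<open>Intersecting with the units turns both convolutions with \<open>k\<close> into pointwise products.\<close>
  have "openin (gtop G) (U \<inter> V \<inter> units G)" "?x \<in> U \<inter> V \<inter> units G"
    using UV x G.openin_units by auto
  from exists_element_on_bisection[OF x(1) this] obtain k where
    k: "k \<in> twisted_algebra" "suppG \<Sigma> q k \<subseteq> U \<inter> V \<inter> units G"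
      "\<And>\<sigma>. \<sigma> \<in> arrows \<Sigma> \<Longrightarrow> q \<sigma> = ?x \<Longrightarrow> k \<sigma> \<in> ring_units"
    by (metis le_inf_iff)
  have kU: "suppG \<Sigma> q k \<subseteq> units G" using k(2) by simp
  define F' where "F' = twisted_conv G \<Sigma> q k F"
  define g where "g = twisted_conv G \<Sigma> q F' k"
  have F'A: "F' \<in> twisted_algebra" and F'I: "F' \<in> I"
    unfolding F'_def using conv_units_left_algebra[OF k(1) FA kU] absorb_left[OF FI FA k(1)] by simp_all
  have gA: "g \<in> twisted_algebra" and gI: "g \<in> I"
    unfolding g_def using conv_units_right_algebra[OF F'A k(1) kU] absorb_right[OF F'I F'A k(1)] by simp_all
  have g: "g \<sigma> = k (src \<Sigma> \<sigma>) * (k (rng \<Sigma> \<sigma>) * F \<sigma>)" for \<sigma>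
    unfolding g_def conv_units_right[OF F'A k(1) kU] unfolding F'_def conv_units_left[OF k(1) FA kU] ..
  have "g u \<noteq> 0"
    using Fu k(3)[OF u_arr(1)] by (simp add: g u_arr ring_unit_mult_eq_0_iff)
  then have "g \<noteq> (\<lambda>_. 0)" by auto
  moreover have "\<forall>\<sigma>. \<sigma> \<notin> Iso_interior \<Sigma> \<longrightarrow> g \<sigma> = 0"
  proof (intro allI impI, rule ccontr)
    fix \<sigma> assume \<sigma>: "\<sigma> \<notin> Iso_interior \<Sigma>" and "g \<sigma> \<noteq> 0"
    then have nz: "k (src \<Sigma> \<sigma>) \<noteq> 0" "k (rng \<Sigma> \<sigma>) \<noteq> 0" "F \<sigma> \<noteq> 0"
      by (auto simp: g)
    then have arr: "\<sigma> \<in> arrows \<Sigma>" using FA by (auto simp: algebra_iff)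
    have "q \<sigma> \<in> suppG \<Sigma> q F"
      using in_suppG_iff[OF _ arr] FA nz(3) by (simp add: algebra_iff)
    moreover have "q \<sigma> \<in> topspace (gtop G) - Iso_interior G"
      using \<sigma> arr q_closed[OF arr] by (simp add: Iso_interior_eq arrows_def)
    ultimately have "(rng G (q \<sigma>), src G (q \<sigma>)) \<in> C"
      unfolding C_def by (intro imageI IntI)
    moreover have "q (rng \<Sigma> \<sigma>) \<in> suppG \<Sigma> q k" "q (src \<Sigma> \<sigma>) \<in> suppG \<Sigma> q k"
      using k(1) nz arr by (simp_all only: algebra_iff in_suppG_iff \<Sigma>.rng_closed \<Sigma>.src_closed simp_thms)
    then have "rng G (q \<sigma>) \<in> U" "src G (q \<sigma>) \<in> V"
      using k(2) arr by auto
    ultimately show False using UV(5) by blast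
  qed
  ultimately show ?thesis using gI gA by (intro that[of g])
qed

end

theorem theorem3p6:
  fixes G :: "'g tgroupoid" and \<Sigma> :: "'s tgroupoid"
    and i :: "'g \<times> 'r::{comm_ring, comm_monoid_mult} \<Rightarrow> 's" and q :: "'s \<Rightarrow> 'g"
    and \<pi> :: "('s \<Rightarrow> 'r) \<Rightarrow> 'q::ring"
  assumes "ample_groupoid G" and "Hausdorff_space (gtop G)"
    and "discrete_twist G \<Sigma> i q"
    and "unit_top \<Sigma> closure_of {u \<in> units \<Sigma>. isotropy \<Sigma> u \<subseteq> Iso_interior \<Sigma>} = units \<Sigma>"
    and "steinberg_ring_hom G \<Sigma> i q \<pi>"
  shows "inj_on \<pi> (twisted_steinberg_algebra G \<Sigma> i q) \<longleftrightarrow>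
    (\<forall>f \<in> twisted_steinberg_algebra (restrict_groupoid G (Iso_interior G))
            (restrict_groupoid \<Sigma> (Iso_interior \<Sigma>)) i q.
       f \<noteq> (\<lambda>_. 0) \<longrightarrow> \<pi> (extend_zero (Iso_interior \<Sigma>) f) \<noteq> 0)"
proof -
  interpret discrete_twist G \<Sigma> i q by fact
  let ?A = "twisted_steinberg_algebra G \<Sigma> i q"
  let ?K = "Iso_interior \<Sigma>"
  have AI: "f \<in> twisted_steinberg_algebra (restrict_groupoid G (Iso_interior G)) (restrict_groupoid \<Sigma> ?K) i q
      \<longleftrightarrow> f \<in> ?A \<and> (\<forall>\<sigma>. \<sigma> \<notin> ?K \<longrightarrow> f \<sigma> = 0)" for f
    by (rule restricted_algebra_iff[OF _ Iso_interior_eq]) (simp add: Iso_interior_def)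
  have extend_zero_eq: "extend_zero ?K f = f" if "\<forall>\<sigma>. \<sigma> \<notin> ?K \<longrightarrow> f \<sigma> = 0" for f :: "'s \<Rightarrow> 'r"
    using that by (auto simp: extend_zero_def)
  have add: "\<pi> (\<lambda>\<sigma>. f \<sigma> + g \<sigma>) = \<pi> f + \<pi> g" and mult: "\<pi> (twisted_conv G \<Sigma> q f g) = \<pi> f * \<pi> g"
    if "f \<in> ?A" "g \<in> ?A" for f g
    using assms(5) that by (simp_all add: steinberg_ring_hom_def)
  have zero: "\<pi> (\<lambda>_. 0) = 0"
    using add[OF zero_algebra zero_algebra] by simp
  show ?thesis
  proof (intro iffI ballI impI)
    fix f assume inj: "inj_on \<pi> ?A" and f: "f \<noteq> (\<lambda>_. 0)"
      "f \<in> twisted_steinberg_algebra (restrict_groupoid G (Iso_interior G)) (restrict_groupoid \<Sigma> ?K) i q"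
    from f(2) have fA: "f \<in> ?A" and "\<forall>\<sigma>. \<sigma> \<notin> ?K \<longrightarrow> f \<sigma> = 0"
      unfolding AI by - (elim conjE, assumption)+
    then have "extend_zero ?K f = f" by (intro extend_zero_eq)
    with fA show "\<pi> (extend_zero ?K f) \<noteq> 0"
      using inj_onD[OF inj _ _ zero_algebra, of f] zero f(1) by auto
  next
    assume nz: "\<forall>f \<in> twisted_steinberg_algebra (restrict_groupoid G (Iso_interior G))
      (restrict_groupoid \<Sigma> ?K) i q. f \<noteq> (\<lambda>_. 0) \<longrightarrow> \<pi> (extend_zero ?K f) \<noteq> 0"
    have ker: "f = (\<lambda>_. 0)" if f: "f \<in> ?A" "\<pi> f = 0" for f
    proof (rule ccontr)
      assume f_nz: "f \<noteq> (\<lambda>_. 0)"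
      let ?I = "{f. \<pi> f = 0}"
      have left: "twisted_conv G \<Sigma> q h k \<in> ?I" and right: "twisted_conv G \<Sigma> q k h \<in> ?I"
        if "k \<in> ?I" "k \<in> ?A" "h \<in> ?A" for k h
        using that by (simp_all add: mult)
      show False
      proof (rule nonzero_on_isotropy_in_absorbing_set[OF assms(4) left right _ f(1) f_nz])
        show "f \<in> ?I" using f(2) by simp
        fix g assume g: "g \<in> ?I" "g \<in> ?A" "g \<noteq> (\<lambda>_. 0)" "\<forall>\<sigma>. \<sigma> \<notin> ?K \<longrightarrow> g \<sigma> = 0"
        have "g \<in> twisted_steinberg_algebra (restrict_groupoid G (Iso_interior G)) (restrict_groupoid \<Sigma> ?K) i q"
          unfolding AI using g(2,4) by (rule conjI)
        from bspec[OF nz this] g(3) have "\<pi> (extend_zero ?K g) \<noteq> 0"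
          by (rule mp)
        then show False using g(1) unfolding extend_zero_eq[OF g(4)] by simp
      qed
    qed
    show "inj_on \<pi> ?A"
    proof (rule inj_onI)
      fix f g assume fg: "f \<in> ?A" "g \<in> ?A" "\<pi> f = \<pi> g"
      let ?d = "\<lambda>\<sigma>. f \<sigma> - g \<sigma>"
      have d: "?d \<in> ?A" using fg by (intro diff_algebra)
      have "\<pi> ?d = 0"
        using add[OF d fg(2)] fg(3) by simp
      from fun_cong[OF ker[OF d this]] show "f = g"
        by (intro ext) simp
    qed
  qed
qed

end
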